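(* Let $K$ be a field, let $S=K[x_1,\dots,x_n]$, and let $I\subset S$ be a polymatroidal ideal. Then $$\mathrm{HS}_1(I^{k+1})=I\cdot \mathrm{HS}_1(I^k)\quad\text{for all } k\ge 1.$$ In particular, $\mathrm{HS}_1(\mathcal{R}(I))=\bigoplus_{k\ge1}\mathrm{HS}_1(I^k)$ is generated in degree one as a graded module over the Rees algebra $\mathcal{R}(I)=\bigoplus_{k\ge0}I^k$.
   Context: $S=K[x_1,\dots,x_n]$ carries its standard $\mathbb{Z}^n$-grading. For a monomial ideal $J$, $\mathcal{G}(J)$ denotes its minimal set of monomial generators, and $\deg_{x_i}(u)$ is the exponent of $x_i$ in the monomial $u$. For $i\ge0$, the $i$th homological shift ideal of a monomial ideal $J\subset S$ is $\mathrm{HS}_i(J)=(\mathbf{x}^{\mathbf a}:\ \mathrm{Tor}_i^S(K,J)_{\mathbf a}\neq0)$, where $\mathbf{x}^{\mathbf a}=x_1^{a_1}\cdots x_n^{a_n}$ (it is the zero ideal if $\mathrm{Tor}_i^S(K,J)=0$). A nonzero monomial ideal $I$ is polymatroidal if all elements of $\mathcal{G}(I)$ have the same degree and the exchange property holds: for all $u,v\in\mathcal{G}(I)$ and all $i$ with $\deg_{x_i}(u)>\deg_{x_i}(v)$, there is $j$ with $\deg_{x_j}(u)<\deg_{x_j}(v)$ such that $x_j(u/x_i)\in\mathcal{G}(I)$. For a polymatroidal ideal $I$ one has $I\cdot\mathrm{HS}_i(I^k)\subset\mathrm{HS}_i(I^{k+1})$ for all $k\ge1$; this makes $\mathrm{HS}_i(\mathcal{R}(I))=\bigoplus_{k\ge1}\mathrm{HS}_i(I^k)$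 (with $\mathrm{HS}_i(I^k)$ in degree $k$) a graded $\mathcal{R}(I)$-module by multiplication. *)

theory Defs
  imports
    "HOL-Library.Poly_Mapping"
    "HOL-Computational_Algebra.Polynomial"
begin

text \<open>
  The polynomial ring \<open>S = K[x\<^sub>1, \<dots>, x\<^sub>n]\<close> is the monoid algebra of the exponent vectors
  \<open>'n \<Rightarrow>\<^sub>0 nat\<close>, where the variables are indexed by a finite type \<open>'n\<close>.
\<close>

type_synonym ('n, 'k) mpoly = "('n \<Rightarrow>\<^sub>0 nat) \<Rightarrow>\<^sub>0 'k"

definition monomial :: "('n \<Rightarrow>\<^sub>0 nat) \<Rightarrow> ('n, 'k::field) mpoly"
  where "monomial u = Poly_Mapping.single u 1"

text \<open>Ideals of a commutative ring are its submodules as a module over itself.\<close>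

definition ideal_gen :: "'a::comm_ring_1 set \<Rightarrow> 'a set"
  where "ideal_gen A = module.span (*) A"

definition ideal_mult :: "'a::comm_ring_1 set \<Rightarrow> 'a set \<Rightarrow> 'a set"
  where "ideal_mult I J = ideal_gen {f * g | f g. f \<in> I \<and> g \<in> J}"

primrec ideal_power :: "'a::comm_ring_1 set \<Rightarrow> nat \<Rightarrow> 'a set"
  where
    "ideal_power I 0 = UNIV"
  | "ideal_power I (Suc k) = ideal_mult I (ideal_power I k)"


section \<open>Monomial and polymatroidal ideals\<close>

definition monomial_ideal :: "('n, 'k::field) mpoly set \<Rightarrow> bool"
  where "monomial_ideal J \<longleftrightarrow> (\<exists>A. J = ideal_gen (monomial ` A))"

text \<open>
  The minimal set of monomial generators, given by the exponent vectors of its elements.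
  It is unique for every monomial ideal, so the description is proper.
\<close>

definition min_gens :: "('n, 'k::field) mpoly set \<Rightarrow> ('n \<Rightarrow>\<^sub>0 nat) set"
  where "min_gens J =
    (THE G. ideal_gen (monomial ` G) = J \<and> (\<forall>H. H \<subset> G \<longrightarrow> ideal_gen (monomial ` H) \<noteq> J))"

definition total_deg :: "('n::finite \<Rightarrow>\<^sub>0 nat) \<Rightarrow> nat"
  where "total_deg u = (\<Sum>i\<in>UNIV. Poly_Mapping.lookup u i)"

definition polymatroidal :: "('n::finite, 'k::field) mpoly set \<Rightarrow> bool"
  where "polymatroidal I \<longleftrightarrow>
    monomial_ideal I \<and> I \<noteq> {0} \<and>
    (\<forall>u\<in>min_gens I. \<forall>v\<in>min_gens I. total_deg u = total_deg v) \<and>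
    (\<forall>u\<in>min_gens I. \<forall>v\<in>min_gens I. \<forall>i. Poly_Mapping.lookup u i > Poly_Mapping.lookup v i \<longrightarrow>
      (\<exists>j. Poly_Mapping.lookup u j < Poly_Mapping.lookup v j \<and>
        Poly_Mapping.single j 1 + (u - Poly_Mapping.single i 1) \<in> min_gens I))"


section \<open>Multigraded Tor\<close>

text \<open>
  A sequence \<open>\<dots> \<rightarrow> F\<^sub>2 \<rightarrow> F\<^sub>1 \<rightarrow> F\<^sub>0 \<rightarrow> K\<close> of \<open>\<int>\<^sup>n\<close>-graded free \<open>S\<close>-modules and homogeneous maps,
  in coordinates: \<open>F\<^sub>i\<close> has the basis \<open>gens F i\<close>, with \<open>b \<in> gens F i\<close> placed in degree
  \<open>shift F i b\<close>; the map \<open>F\<^sub>i\<^sub>+\<^sub>1 \<rightarrow> F\<^sub>i\<close> sends the basis element \<open>b\<close> to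
  \<open>\<Sum>c\<in>gens F i. diff F i b c \<cdot> c\<close>; and \<open>F\<^sub>0 \<rightarrow> K\<close> sends \<open>b\<close> to \<open>aug F b\<close>.
\<close>

record (overloaded) ('n, 'k::field) free_seq =
  gens :: "nat \<Rightarrow> nat set"
  shift :: "nat \<Rightarrow> nat \<Rightarrow> 'n \<Rightarrow> int"
  diff :: "nat \<Rightarrow> nat \<Rightarrow> nat \<Rightarrow> ('n, 'k) mpoly"
  aug :: "nat \<Rightarrow> 'k"

text \<open>
  For an ideal \<open>J\<close>, the module \<open>F\<^sub>i \<otimes> J\<close> is the direct sum of one copy of \<open>J\<close> for each basis
  element of \<open>F\<^sub>i\<close>, i.e. the module of families \<open>v\<close> of elements of \<open>J\<close> indexed by \<open>gens F i\<close>.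
  The case \<open>J = UNIV\<close> is \<open>F\<^sub>i\<close> itself.
\<close>

definition chains_of ::
    "('n, 'k::field) free_seq \<Rightarrow> ('n, 'k) mpoly set \<Rightarrow> nat \<Rightarrow> (nat \<Rightarrow> ('n, 'k) mpoly) set"
  where "chains_of F J i = {v. (\<forall>b\<in>gens F i. v b \<in> J) \<and> (\<forall>b. b \<notin> gens F i \<longrightarrow> v b = 0)}"

definition has_degree :: "('n \<Rightarrow> int) \<Rightarrow> ('n, 'k::field) mpoly \<Rightarrow> bool"
  where "has_degree a f \<longleftrightarrow> (\<forall>m\<in>Poly_Mapping.keys f. \<forall>j. int (Poly_Mapping.lookup m j) = a j)"

definition chains_at ::
    "('n, 'k::field) free_seq \<Rightarrow> ('n, 'k) mpoly set \<Rightarrow> nat \<Rightarrow> ('n \<Rightarrow> int) \<Rightarrow>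
      (nat \<Rightarrow> ('n, 'k) mpoly) set"
  where "chains_at F J i a =
    {v \<in> chains_of F J i. \<forall>b\<in>gens F i. has_degree (\<lambda>j. a j - shift F i b j) (v b)}"

definition bd ::
    "('n, 'k::field) free_seq \<Rightarrow> nat \<Rightarrow> (nat \<Rightarrow> ('n, 'k) mpoly) \<Rightarrow> nat \<Rightarrow> ('n, 'k) mpoly"
  where "bd F i v =
    (\<lambda>c. if c \<in> gens F i then \<Sum>b\<in>gens F (Suc i). v b * diff F i b c else 0)"

text \<open>\<open>S\<close> acts on \<open>K = S/(x\<^sub>1, \<dots>, x\<^sub>n)\<close> through the constant coefficient \<open>Poly_Mapping.lookup f 0\<close>.\<close>

definition aug_map :: "('n, 'k::field) free_seq \<Rightarrow> (nat \<Rightarrow> ('n, 'k) mpoly) \<Rightarrow> 'k"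
  where "aug_map F v = (\<Sum>b\<in>gens F 0. Poly_Mapping.lookup (v b) 0 * aug F b)"

text \<open>\<open>F\<close> is a \<open>\<int>\<^sup>n\<close>-graded free resolution of \<open>K\<close>, where \<open>K\<close> sits in degree \<open>0\<close>.\<close>

definition graded_free_resolution :: "('n, 'k::field) free_seq \<Rightarrow> bool"
  where "graded_free_resolution F \<longleftrightarrow>
    (\<forall>i. finite (gens F i)) \<and>
    (\<forall>i. \<forall>b\<in>gens F (Suc i). \<forall>c\<in>gens F i.
      has_degree (\<lambda>j. shift F (Suc i) b j - shift F i c j) (diff F i b c)) \<and>
    (\<forall>b\<in>gens F 0. aug F b \<noteq> 0 \<longrightarrow> shift F 0 b = (\<lambda>_. 0)) \<and>
    aug_map F ` chains_of F UNIV 0 = UNIV \<and>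
    bd F 0 ` chains_of F UNIV 1 = {v \<in> chains_of F UNIV 0. aug_map F v = 0} \<and>
    (\<forall>i. bd F (Suc i) ` chains_of F UNIV (i + 2) =
      {v \<in> chains_of F UNIV (Suc i). bd F i v = (\<lambda>_. 0)})"

text \<open>
  Cycles and boundaries of degree \<open>a\<close> in \<open>F\<^sub>i \<otimes> J\<close>, for the complex \<open>F \<otimes> J\<close> that ends in
  \<open>F\<^sub>0 \<otimes> J \<rightarrow> 0\<close>.
\<close>

definition cycles_at ::
    "('n, 'k::field) free_seq \<Rightarrow> ('n, 'k) mpoly set \<Rightarrow> nat \<Rightarrow> ('n \<Rightarrow> int) \<Rightarrow>
      (nat \<Rightarrow> ('n, 'k) mpoly) set"
  where "cycles_at F J i a =
    {v \<in> chains_at F J i a. case i of 0 \<Rightarrow> True | Suc j \<Rightarrow> bd F j v = (\<lambda>_. 0)}"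

definition boundaries_at ::
    "('n, 'k::field) free_seq \<Rightarrow> ('n, 'k) mpoly set \<Rightarrow> nat \<Rightarrow> ('n \<Rightarrow> int) \<Rightarrow>
      (nat \<Rightarrow> ('n, 'k) mpoly) set"
  where "boundaries_at F J i a = bd F i ` chains_at F J (Suc i) a"

text \<open>
  \<open>Tor\<^sub>i\<^sup>S(K, J)\<^sub>a \<noteq> 0\<close>: the homology of \<open>F \<otimes> J\<close> in position \<open>i\<close> and degree \<open>a\<close> is nonzero for a
  graded free resolution \<open>F\<close> of \<open>K\<close>. As usual it does not matter which one is taken.
\<close>

definition tor_nonzero :: "nat \<Rightarrow> ('n, 'k::field) mpoly set \<Rightarrow> ('n \<Rightarrow> int) \<Rightarrow> bool"
  where "tor_nonzero i J a \<longleftrightarrow>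
    (\<exists>F. graded_free_resolution F \<and> cycles_at F J i a \<noteq> boundaries_at F J i a)"


section \<open>Homological shift ideals and the Rees algebra\<close>

text \<open>\<open>Tor\<^sub>i\<^sup>S(K, J)\<close> lives in degrees from \<open>\<nat>\<^sup>n\<close>, so only these are considered.\<close>

definition HS :: "nat \<Rightarrow> ('n, 'k::field) mpoly set \<Rightarrow> ('n, 'k) mpoly set"
  where "HS i J = ideal_gen {monomial a | a. tor_nonzero i J (\<lambda>j. int (Poly_Mapping.lookup a j))}"

text \<open>
  The Rees algebra and the module \<open>HS\<^sub>i(R(I))\<close> are realised inside \<open>S[t]\<close>: the component of
  degree \<open>k\<close> consists of the coefficients of \<open>t\<^sup>k\<close>, and the module structure is multiplication
  in \<open>S[t]\<close>.
\<close>

definition rees :: "('n, 'k::field) mpoly set \<Rightarrow> ('n, 'k) mpoly poly set"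
  where "rees I = {p. \<forall>k. coeff p k \<in> ideal_power I k}"

definition HS_rees :: "nat \<Rightarrow> ('n, 'k::field) mpoly set \<Rightarrow> ('n, 'k) mpoly poly set"
  where "HS_rees i I = {p. coeff p 0 = 0 \<and> (\<forall>k\<ge>1. coeff p k \<in> HS i (ideal_power I k))}"

definition graded_component :: "'a::comm_ring_1 poly set \<Rightarrow> nat \<Rightarrow> 'a poly set"
  where "graded_component M d = {p \<in> M. \<forall>k. k \<noteq> d \<longrightarrow> coeff p k = 0}"

definition span_over :: "'a::comm_ring_1 set \<Rightarrow> 'a set \<Rightarrow> 'a set"
  where "span_over R A =
    {(\<Sum>m\<in>T. r m * m) | T r. finite T \<and> T \<subseteq> A \<and> (\<forall>m\<in>T. r m \<in> R)}"

definition generated_in_degree :: "nat \<Rightarrow> 'a::comm_ring_1 poly set \<Rightarrow> 'a poly set \<Rightarrow> bool"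
  where "generated_in_degree d R M \<longleftrightarrow> M = span_over R (graded_component M d)"

end

theory Submission
  imports Defs
begin

text \<open>
  \<open>Tor\<^sub>1(K, J)\<close> in degree \<open>a\<close> is nonzero iff the graph on the variables \<open>i\<close> with \<open>x\<^sup>a / x\<^sub>i \<in> J\<close>, with
  edges the pairs with \<open>x\<^sup>a / (x\<^sub>i x\<^sub>j) \<in> J\<close>, is disconnected. If \<open>J\<close> is polymatroidal, generated in
  degree \<open>d\<close>, walking from one generator to another by exchanges shows that this graph is connected
  when \<open>a\<close> has degree at least \<open>d + 2\<close>. Hence \<open>HS\<^sub>1(J)\<close> is generated by the lcms of generators that
  differ by one exchange. The generators of \<open>I\<^sup>k\<close> are the products of \<open>k\<close> generators of \<open>I\<close>; they
  again satisfy the exchange property. If two of them differ by an exchange that raises the exponent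
  of \<open>x\<^sub>j\<close>, then in one factor alone the exponent of \<open>x\<^sub>j\<close> can be raised by an exchange, and for
  \<open>k \<ge> 2\<close> any other factor can be split off from the lcm.
\<close>

section \<open>Bases of discrete polymatroids\<close>

text \<open>\<open>tor_nonzero\<close> asks only for some graded free resolution of K with nonzero
  homology, and resolutions are never compared with each other. This makes the two directions
  asymmetric. Vanishing has to be shown for every resolution F, from surjectivity of the
  augmentation, exactness at F_0 and F_1, and homogeneity; hence the explicit chains in
  \<open>cycle_is_boundary\<close>. For nonvanishing one resolution suffices. The Koszul complex is
  chosen because there a degree count excludes boundaries; the price is a proof of its exactness.
  The bound d + 2 arises as follows: an exchange of x_p for x_q between generators dividing x^a
  turns the cofactor x^a/u = r x_q into r x_p, and the two share a variable as soon as r is not 1. A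
  vertex forces degree at least d + 1, so only d + 1 remains. The exchange property lowers a
  prescribed coordinate, whereas lcms u x_j call for raising one; \<open>dual_exchange\<close>
  supplies that form.\<close>

abbreviation var :: "'n \<Rightarrow> ('n \<Rightarrow>\<^sub>0 nat)"
  where "var i \<equiv> Poly_Mapping.single i (Suc 0)"

lemma lookup_var: "Poly_Mapping.lookup (var i) j = (if i = j then 1 else 0)"
  by (simp add: lookup_single when_def)

lemma total_deg_add: "total_deg (u + v) = total_deg u + total_deg v"
  by (simp add: total_deg_def lookup_add sum.distrib)

lemma total_deg_var: "total_deg (var i) = 1"
  by (simp add: total_deg_def lookup_var)

lemma total_deg_eq_0: "total_deg u = 0 \<longleftrightarrow> u = 0"
  by (auto simp: total_deg_def intro: poly_mapping_eqI)

lemma minus_var_add: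
  assumes "Poly_Mapping.lookup u i > 0"
  shows "u - var i + var i = u"
  using assms by (intro poly_mapping_eqI) (auto simp: lookup_add lookup_minus lookup_var)

text \<open>Subtraction of exponents truncates; writing \<open>u = w + var i\<close> keeps later
  computations in a cancellative monoid.\<close>

lemma ex_var_add:
  assumes "Poly_Mapping.lookup u i > 0"
  obtains w where "u = w + var i"
  using minus_var_add[OF assms] by metis

definition polymatroid_bases :: "nat \<Rightarrow> ('n::finite \<Rightarrow>\<^sub>0 nat) set \<Rightarrow> bool"
  where "polymatroid_bases d B \<longleftrightarrow>
    (\<forall>u\<in>B. total_deg u = d) \<and>
    (\<forall>u\<in>B. \<forall>v\<in>B. \<forall>i. Poly_Mapping.lookup u i > Poly_Mapping.lookup v i \<longrightarrow>
      (\<exists>j. Poly_Mapping.lookup u j < Poly_Mapping.lookup v j \<and> var j + (u - var i) \<in> B))"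

lemma polymatroid_bases_deg: "polymatroid_bases d B \<Longrightarrow> u \<in> B \<Longrightarrow> total_deg u = d"
  by (simp add: polymatroid_bases_def)

lemma polymatroid_bases_exchange:
  assumes "polymatroid_bases d B" "u \<in> B" "v \<in> B"
    "Poly_Mapping.lookup v i < Poly_Mapping.lookup u i"
  obtains j where "Poly_Mapping.lookup u j < Poly_Mapping.lookup v j" "var j + (u - var i) \<in> B"
  using assms unfolding polymatroid_bases_def by blast

section \<open>Minkowski sums of polymatroids\<close>

definition sumset :: "'a::plus set \<Rightarrow> 'a set \<Rightarrow> 'a set"
  where "sumset A B = {a + b | a b. a \<in> A \<and> b \<in> B}"

lemma sumsetI: "a \<in> A \<Longrightarrow> b \<in> B \<Longrightarrow> a + b \<in> sumset A B"
  by (auto simp: sumset_def)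

lemma sumsetE:
  assumes "x \<in> sumset A B" obtains a b where "x = a + b" "a \<in> A" "b \<in> B"
  using assms by (auto simp: sumset_def)

text \<open>With truncated subtraction, \<open>total_deg (u - v)\<close> adds up the excess of
  \<open>u\<close> over \<open>v\<close>. The exchange removes one unit of excess at
  \<open>i\<close>, and at \<open>j\<close> the raised coordinate still does not exceed that of
  \<open>v\<close>. This is the termination measure of all exchange walks below.\<close>

lemma exchange_decreases:
  assumes "Poly_Mapping.lookup v i < Poly_Mapping.lookup u i"
    "Poly_Mapping.lookup u j < Poly_Mapping.lookup v j"
  shows "total_deg (var j + (u - var i) - v) < total_deg (u - v)"
  unfolding total_deg_def
proof (rule sum_strict_mono_ex1)
  show "\<forall>x\<in>UNIV. Poly_Mapping.lookup (var j + (u - var i) - v) x \<le> Poly_Mapping.lookup (u - v) x"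
    using assms by (auto simp: lookup_add lookup_minus lookup_var)
  show "\<exists>x\<in>UNIV. Poly_Mapping.lookup (var j + (u - var i) - v) x < Poly_Mapping.lookup (u - v) x"
    using assms by (intro bexI[of _ i]) (auto simp: lookup_add lookup_minus lookup_var)
qed simp

text \<open>
  An exchange in one summand may spoil the sum in a coordinate \<open>j\<close>, where it then has to be
  repaired by a further exchange; this terminates because the summands approach their targets.
\<close>

lemma sumset_exchange:
  assumes A: "polymatroid_bases d A" and B: "polymatroid_bases e B"
  shows "\<lbrakk>a \<in> A; a' \<in> A; b \<in> B; b' \<in> B;
      Poly_Mapping.lookup (a' + b') i < Poly_Mapping.lookup (a + b) i\<rbrakk> \<Longrightarrow>
    \<exists>j. Poly_Mapping.lookup (a + b) j < Poly_Mapping.lookup (a' + b') j \<and>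
      var j + (a + b - var i) \<in> sumset A B"
proof (induction "total_deg (a - a') + total_deg (b - b')" arbitrary: a b i rule: less_induct)
  case less
  \<comment> \<open>An excess of the sum at \<open>i\<close> is an excess of one summand; the
    exchange is made there. \<open>l\<close> differs from \<open>i\<close> because that summand is
    above its target at \<open>i\<close> and below it at \<open>l\<close>.\<close>
  have step: "\<exists>c\<in>A. \<exists>c'\<in>B. \<exists>l. c + c' = var l + (a + b - var i) \<and> l \<noteq> i \<and>
      total_deg (c - a') + total_deg (c' - b') < total_deg (a - a') + total_deg (b - b')"
  proof (cases "Poly_Mapping.lookup a' i < Poly_Mapping.lookup a i")
    case True
    obtain l where l: "Poly_Mapping.lookup a l < Poly_Mapping.lookup a' l" "var l + (a - var i) \<in> A"
      using polymatroid_bases_exchange[OF A less.prems(1,2) True] .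
    have "var l + (a - var i) + b = var l + (a + b - var i)"
      using True by (intro poly_mapping_eqI) (auto simp: lookup_add lookup_minus lookup_var)
    with l exchange_decreases[OF True l(1)] less.prems(3) True show ?thesis
      by (metis add_less_cancel_right less_asym)
  next
    case False
    then have i: "Poly_Mapping.lookup b' i < Poly_Mapping.lookup b i"
      using less.prems(5) by (simp add: lookup_add)
    obtain l where l: "Poly_Mapping.lookup b l < Poly_Mapping.lookup b' l" "var l + (b - var i) \<in> B"
      using polymatroid_bases_exchange[OF B less.prems(3,4) i] .
    have "a + (var l + (b - var i)) = var l + (a + b - var i)"
      using i by (intro poly_mapping_eqI) (auto simp: lookup_add lookup_minus lookup_var)
    with l exchange_decreases[OF i l(1)] less.prems(1) i show ?thesis
      by (metis add_less_cancel_left less_asym)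
  qed
  then obtain c c' l where c: "c \<in> A" "c' \<in> B" "c + c' = var l + (a + b - var i)" "l \<noteq> i"
    "total_deg (c - a') + total_deg (c' - b') < total_deg (a - a') + total_deg (b - b')"
    by blast
  have look: "Poly_Mapping.lookup (c + c') x = (if x = l then Poly_Mapping.lookup (a + b) x + 1
      else if x = i then Poly_Mapping.lookup (a + b) x - 1 else Poly_Mapping.lookup (a + b) x)" for x
    unfolding c(3) using c(4) by (auto simp: lookup_add lookup_minus lookup_var)
  show ?case
  proof (cases "Poly_Mapping.lookup (a + b) l < Poly_Mapping.lookup (a' + b') l")
    case True
    then show ?thesis
      using sumsetI[OF c(1,2)] c(3) by auto
  next
    case False
    then have "Poly_Mapping.lookup (a' + b') l < Poly_Mapping.lookup (c + c') l"
      unfolding look by simp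
    from less.hyps[OF c(5) c(1) less.prems(2) c(2) less.prems(4) this]
    obtain j where j: "Poly_Mapping.lookup (c + c') j < Poly_Mapping.lookup (a' + b') j"
      "var j + (c + c' - var l) \<in> sumset A B"
      by blast
    \<comment> \<open>At \<open>l\<close> and at \<open>i\<close> the sum \<open>c + c'\<close> is
      not below the target, at \<open>i\<close> because only one unit of a positive excess was
      removed. The intermediate \<open>l\<close> then cancels, and the two exchanges combine to one
      of \<open>i\<close> for \<open>j\<close>.\<close>
    have "j \<noteq> l" "j \<noteq> i"
      using j(1) False less.prems(5) unfolding look by (auto split: if_splits)
    moreover have "c + c' - var l = a + b - var i"
      unfolding c(3) by simp
    ultimately show ?thesis
      using j unfolding look by auto
  qed
qed

lemma polymatroid_bases_sumset:
  assumes "polymatroid_bases d A" "polymatroid_bases e B"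
  shows "polymatroid_bases (d + e) (sumset A B)"
  unfolding polymatroid_bases_def
proof (intro conjI ballI allI impI)
  fix u assume "u \<in> sumset A B"
  with assms show "total_deg u = d + e"
    by (auto elim!: sumsetE simp: total_deg_add polymatroid_bases_deg)
next
  fix u v i
  assume "u \<in> sumset A B" "v \<in> sumset A B" "Poly_Mapping.lookup v i < Poly_Mapping.lookup u i"
  with sumset_exchange[OF assms] show "\<exists>j. Poly_Mapping.lookup u j < Poly_Mapping.lookup v j \<and>
      var j + (u - var i) \<in> sumset A B"
    by (auto elim!: sumsetE)
qed

primrec multiple :: "'a::monoid_add set \<Rightarrow> nat \<Rightarrow> 'a set"
  where
    "multiple B 0 = {0}"
  | "multiple B (Suc k) = sumset B (multiple B k)"

lemma polymatroid_bases_multiple: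
  assumes "polymatroid_bases d B"
  shows "polymatroid_bases (k * d) (multiple B k)"
proof (induction k)
  case 0
  show ?case by (simp add: polymatroid_bases_def total_deg_eq_0)
next
  case (Suc k)
  then show ?case
    using polymatroid_bases_sumset[OF assms] by simp
qed

text \<open>Among the bases that exceed \<open>u\<close> at \<open>j\<close>, one closest to \<open>u\<close> is of the form required here.\<close>

lemma dual_exchange:
  assumes B: "polymatroid_bases d B" and u: "u \<in> B" and v: "v \<in> B"
    and j: "Poly_Mapping.lookup u j < Poly_Mapping.lookup v j"
  obtains w p where "w \<in> B" "p \<noteq> j" "w + var p = u + var j"
proof -
  define P where "P w \<longleftrightarrow> w \<in> B \<and> Poly_Mapping.lookup u j < Poly_Mapping.lookup w j" for w
  obtain w where w: "P w" and min: "\<And>w'. P w' \<Longrightarrow> total_deg (w - u) \<le> total_deg (w' - u)"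
    using exists_least_iff[of "\<lambda>n. \<exists>w. P w \<and> total_deg (w - u) = n"] v j
    unfolding P_def by (metis linorder_not_less)
  \<comment> \<open>Any further excess, be it outside \<open>j\<close> or a second unit at
    \<open>j\<close>, could be exchanged away towards \<open>u\<close> while staying in
    \<open>P\<close>, contradicting minimality.\<close>
  have only: "i = j \<and> Poly_Mapping.lookup w j = Poly_Mapping.lookup u j + 1"
    if i: "Poly_Mapping.lookup u i < Poly_Mapping.lookup w i" for i
  proof (rule ccontr)
    assume neg: "\<not> ?thesis"
    obtain q where q: "Poly_Mapping.lookup w q < Poly_Mapping.lookup u q" "var q + (w - var i) \<in> B"
      using polymatroid_bases_exchange[OF B _ u i] w unfolding P_def by blast
    have "Poly_Mapping.lookup u j < Poly_Mapping.lookup (var q + (w - var i)) j"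
      using w neg i unfolding P_def by (auto simp: lookup_add lookup_minus lookup_var)
    with q have "P (var q + (w - var i))"
      by (simp add: P_def)
    from min[OF this] exchange_decreases[OF i q(1)] show False
      by simp
  qed
  have wB: "w \<in> B" and wj: "Poly_Mapping.lookup w j = Poly_Mapping.lookup u j + 1"
    using w only[of j] by (auto simp: P_def)
  have le: "Poly_Mapping.lookup w i \<le> Poly_Mapping.lookup (u + var j) i" for i
    using only[of i] wj by (cases "i = j") (auto simp: lookup_add lookup_var intro: leI)
  have eq: "w + (u + var j - w) = u + var j"
    using le by (intro poly_mapping_eqI) (simp add: lookup_add lookup_minus)
  \<comment> \<open>\<open>w\<close> divides \<open>u + var j\<close>, and the degrees leave exactly
    one variable \<open>p\<close> for the quotient.\<close>
  have "total_deg (w + (u + var j - w)) = d + 1"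
    unfolding eq using polymatroid_bases_deg[OF B u] by (simp add: total_deg_add total_deg_var)
  then have deg1: "total_deg (u + var j - w) = 1"
    using polymatroid_bases_deg[OF B wB] by (simp add: total_deg_add)
  then have "u + var j - w \<noteq> 0"
    by (metis total_deg_eq_0 zero_neq_one)
  then obtain p where p: "Poly_Mapping.lookup (u + var j - w) p > 0"
    by (metis gr0I lookup_zero poly_mapping_eqI)
  then obtain r where r: "u + var j - w = r + var p"
    by (rule ex_var_add)
  with deg1 have "r = 0"
    by (simp add: total_deg_add total_deg_var total_deg_eq_0)
  moreover have "p \<noteq> j"
    using p wj by (auto simp: lookup_add lookup_minus lookup_var)
  ultimately show ?thesis
    using that[OF wB] r eq by simp
qed

text \<open>The exponents of the lcms of two bases that differ by a single exchange.\<close>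

definition linear_lcms :: "('n \<Rightarrow>\<^sub>0 nat) set \<Rightarrow> ('n \<Rightarrow>\<^sub>0 nat) set"
  where "linear_lcms B = {a. \<exists>u\<in>B. \<exists>v\<in>B. \<exists>i j. i \<noteq> j \<and> a = u + var i \<and> a = v + var j}"

text \<open>For the harder inclusion, \<open>v\<close> serves only as a witness that coordinate
  \<open>j\<close> of \<open>u\<close> can be raised: \<open>u + var j\<close> is a linear lcm
  whatever the partner. So the factors of \<open>u\<close> and \<open>v\<close> need not be matched;
  one coordinate inequality between summands is enough.\<close>

lemma linear_lcms_multiple:
  assumes B: "polymatroid_bases d B"
  shows "linear_lcms (multiple B (Suc (Suc k))) = sumset B (linear_lcms (multiple B (Suc k)))"
proof (intro equalityI subsetI)
  fix a assume "a \<in> sumset B (linear_lcms (multiple B (Suc k)))"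
  then obtain b u v i j where *: "b \<in> B" "u \<in> multiple B (Suc k)" "v \<in> multiple B (Suc k)" "i \<noteq> j"
    "a = b + (u + var i)" "u + var i = v + var j"
    unfolding sumset_def linear_lcms_def by blast
  then have "b + u \<in> multiple B (Suc (Suc k))" "b + v \<in> multiple B (Suc (Suc k))"
    "a = b + u + var i" "a = b + v + var j"
    by (auto intro!: sumsetI simp del: multiple.simps(2) simp: multiple.simps(2)[of B "Suc k"] add.assoc)
  with * show "a \<in> linear_lcms (multiple B (Suc (Suc k)))"
    unfolding linear_lcms_def by blast
next
  fix a assume "a \<in> linear_lcms (multiple B (Suc (Suc k)))"
  then obtain u v i j where a: "u \<in> multiple B (Suc (Suc k))" "v \<in> multiple B (Suc (Suc k))" "i \<noteq> j"
    "a = u + var j" "a = v + var i"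
    unfolding linear_lcms_def by blast
  obtain u1 u2 u' where u: "u = u1 + (u2 + u')" "u1 \<in> B" "u2 \<in> B" "u' \<in> multiple B k"
    using a(1) by (auto elim!: sumsetE)
  obtain v1 v' where v: "v = v1 + v'" "v1 \<in> B" "v' \<in> multiple B (Suc k)"
    using sumsetE[OF a(2)[unfolded multiple.simps(2)[of B "Suc k"]]] .
  have "Poly_Mapping.lookup u j < Poly_Mapping.lookup v j"
  proof -
    have "Poly_Mapping.lookup (u + var j) j = Poly_Mapping.lookup (v + var i) j"
      using a by simp
    with a(3) show ?thesis by (simp add: lookup_add lookup_var)
  qed
  then consider "Poly_Mapping.lookup u1 j < Poly_Mapping.lookup v1 j"
    | "Poly_Mapping.lookup (u2 + u') j < Poly_Mapping.lookup v' j"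
    unfolding u v by (fastforce simp: lookup_add)
  then show "a \<in> sumset B (linear_lcms (multiple B (Suc k)))"
  proof cases
    case 1
    obtain w p where w: "w \<in> B" "p \<noteq> j" "w + var p = u1 + var j"
      using dual_exchange[OF B u(2) v(2) 1] .
    have "w + u' + var p = (w + var p) + u'"
      by (simp add: ac_simps)
    then have "u1 + u' + var j = w + u' + var p"
      unfolding w(3) by (simp add: ac_simps)
    moreover have "u1 + u' \<in> multiple B (Suc k)" "w + u' \<in> multiple B (Suc k)"
      using u w by (auto intro: sumsetI)
    ultimately have "u1 + u' + var j \<in> linear_lcms (multiple B (Suc k))"
      unfolding linear_lcms_def using w(2) by blast
    from sumsetI[OF u(3) this] show ?thesis
      unfolding a(4) u(1) by (simp add: ac_simps)
  next
    \<comment> \<open>Here \<open>u1\<close> is the factor split off, and the exchange takes place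
      in the block \<open>u2 + u'\<close> as a base of the multiple.\<close>
    case 2
    have u2: "u2 + u' \<in> multiple B (Suc k)"
      using u by (auto intro: sumsetI)
    obtain w p where w: "w \<in> multiple B (Suc k)" "p \<noteq> j" "w + var p = u2 + u' + var j"
      using dual_exchange[OF polymatroid_bases_multiple[OF B] u2 v(3) 2] .
    then have "u2 + u' + var j \<in> linear_lcms (multiple B (Suc k))"
      unfolding linear_lcms_def using u2 by (metis (mono_tags, lifting) mem_Collect_eq)
    from sumsetI[OF u(2) this] show ?thesis
      unfolding a(4) u(1) by (simp add: ac_simps)
  qed
qed

section \<open>Linear relations\<close>

definition upset :: "'a::plus set \<Rightarrow> 'a set"
  where "upset A = {g + w | g w. g \<in> A}"

text \<open>
  The 1-skeleton of the upper Koszul simplicial complex of a monomial ideal in degree \<open>a\<close>, where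
  \<open>M\<close> is the set of exponents of the monomials in the ideal.
\<close>

definition koszul_vertex :: "('n \<Rightarrow>\<^sub>0 nat) set \<Rightarrow> ('n \<Rightarrow>\<^sub>0 nat) \<Rightarrow> 'n \<Rightarrow> bool"
  where "koszul_vertex M a i \<longleftrightarrow> (\<exists>m\<in>M. a = m + var i)"

definition koszul_edge :: "('n \<Rightarrow>\<^sub>0 nat) set \<Rightarrow> ('n \<Rightarrow>\<^sub>0 nat) \<Rightarrow> 'n \<Rightarrow> 'n \<Rightarrow> bool"
  where "koszul_edge M a i j \<longleftrightarrow> (\<exists>m\<in>M. a = m + var i + var j)"

lemma koszul_edgeI:
  assumes "u \<in> B" "a = u + s" "Poly_Mapping.lookup s i > 0" "Poly_Mapping.lookup s j > 0" "i \<noteq> j"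
  shows "koszul_edge (upset B) a i j"
proof -
  obtain t where t: "s = t + var i"
    using assms(3) by (rule ex_var_add)
  then have "Poly_Mapping.lookup t j > 0"
    using assms(4,5) by (simp add: lookup_add lookup_var)
  then obtain r where "t = r + var j"
    by (rule ex_var_add)
  with t assms have "a = (u + r) + var i + var j" "u + r \<in> upset B"
    by (auto simp: ac_simps upset_def)
  then show ?thesis unfolding koszul_edge_def by blast
qed

text \<open>A generator \<open>u\<close> dividing x^a makes the support of its cofactor
  \<open>s\<close> a clique, by \<open>koszul_edgeI\<close>. One exchange towards \<open>v\<close>
  replaces \<open>s = r + var q\<close> by \<open>r + var p\<close>, so consecutive cliques meet in
  the support of \<open>r\<close>.\<close>

lemma koszul_connected:
  assumes B: "polymatroid_bases d B" and deg: "total_deg a \<ge> d + 2"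
  shows "\<lbrakk>u \<in> B; v \<in> B; a = u + s; a = v + t;
      Poly_Mapping.lookup s i > 0; Poly_Mapping.lookup t j > 0\<rbrakk> \<Longrightarrow>
    (koszul_edge (upset B) a)\<^sup>*\<^sup>* i j"
proof (induction "total_deg (u - v)" arbitrary: u s i rule: less_induct)
  case less
  show ?case
  proof (cases "u = v")
    case True
    then have "s = t" using less.prems by simp
    then have "i = j \<or> koszul_edge (upset B) a i j"
      using koszul_edgeI[OF less.prems(1,3,5)] less.prems(6) by blast
    then show ?thesis by auto
  next
    case False
    have "total_deg u = total_deg v"
      using polymatroid_bases_deg[OF B] less.prems by simp
    have "\<exists>p. Poly_Mapping.lookup v p < Poly_Mapping.lookup u p"
    proof (rule ccontr)
      assume "\<not> ?thesis"
      then have le: "Poly_Mapping.lookup u p \<le> Poly_Mapping.lookup v p" for p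
        by (simp add: not_less)
      have "u + (v - u) = v"
        using le by (intro poly_mapping_eqI) (simp add: lookup_add lookup_minus)
      then show False
        using \<open>total_deg u = total_deg v\<close> False
        by (metis add.right_neutral add_left_cancel total_deg_add total_deg_eq_0)
    qed
    then obtain p where p: "Poly_Mapping.lookup v p < Poly_Mapping.lookup u p" ..
    obtain q where q: "Poly_Mapping.lookup u q < Poly_Mapping.lookup v q" "var q + (u - var p) \<in> B"
      using polymatroid_bases_exchange[OF B less.prems(1,2) p] .
    have sq: "Poly_Mapping.lookup s q > 0"
    proof -
      have "Poly_Mapping.lookup (u + s) q = Poly_Mapping.lookup (v + t) q"
        using less.prems by simp
      with q(1) show ?thesis by (simp add: lookup_add)
    qed
    then obtain r where r: "s = r + var q" by (rule ex_var_add)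
    have a: "a = var q + (u - var p) + (r + var p)"
    proof -
      have "a = u - var p + var p + r + var q"
        using less.prems(3) r minus_var_add[of u p] p by (simp add: ac_simps)
      then show ?thesis by (simp add: ac_simps)
    qed
    \<comment> \<open>The only use of the bound d + 2: the cofactor has degree at least 2, so
      \<open>r\<close> retains a variable.\<close>
    have "total_deg r > 0"
      using deg polymatroid_bases_deg[OF B less.prems(1)] unfolding less.prems(3) r
      by (simp add: total_deg_add total_deg_var)
    then obtain k where k: "Poly_Mapping.lookup r k > 0"
      by (metis gr0I lookup_zero poly_mapping_eqI total_deg_eq_0 less_numeral_extra(3))
    have "(koszul_edge (upset B) a)\<^sup>*\<^sup>* k j"
      using less.hyps[OF exchange_decreases[OF p q(1)] q(2) less.prems(2) a less.prems(4)]
        k less.prems(6) by (simp add: lookup_add)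
    moreover have "i = k \<or> koszul_edge (upset B) a i k"
      using koszul_edgeI[OF less.prems(1,3,5)] k r by (auto simp: lookup_add)
    ultimately show ?thesis
      by (auto intro: converse_rtranclp_into_rtranclp)
  qed
qed

text \<open>A vertex gives degree at least d + 1 and \<open>koszul_connected\<close> excludes d + 2,
  so the cofactors \<open>s\<close> and \<open>t\<close> are trivial. Reflexivity of the closure
  yields \<open>i \<noteq> j\<close>.\<close>

lemma disconnected_imp_linear_lcm:
  assumes B: "polymatroid_bases d B"
    and vert: "koszul_vertex (upset B) a i" "koszul_vertex (upset B) a j"
    and disc: "\<not> (koszul_edge (upset B) a)\<^sup>*\<^sup>* i j"
  shows "a \<in> linear_lcms B"
proof -
  obtain u v s t where uv: "u \<in> B" "v \<in> B" "a = u + s + var i" "a = v + t + var j"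
    using vert unfolding koszul_vertex_def upset_def by blast
  have "total_deg a < d + 2"
  proof (rule ccontr)
    assume "\<not> ?thesis"
    then have "(koszul_edge (upset B) a)\<^sup>*\<^sup>* i j"
      using koszul_connected[OF B, of a u v "s + var i" "t + var j" i j] uv
      by (auto simp: ac_simps lookup_add lookup_var)
    with disc show False ..
  qed
  moreover have "total_deg a = d + total_deg s + 1" "total_deg a = d + total_deg t + 1"
    using uv polymatroid_bases_deg[OF B] by (metis total_deg_add total_deg_var)+
  ultimately have "s = 0" "t = 0"
    by (auto simp flip: total_deg_eq_0)
  moreover have "i \<noteq> j" using disc by auto
  ultimately have "a = u + var i" "a = v + var j" "i \<noteq> j"
    using uv(3,4) by auto
  with uv(1,2) show ?thesis
    unfolding linear_lcms_def by blast
qed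

section \<open>Ideals generated by monomials\<close>

lemma module_mult: "module ((*) :: 'a::comm_ring_1 \<Rightarrow> 'a \<Rightarrow> 'a)"
  by unfold_locales (simp_all add: algebra_simps)

lemma ideal_gen_base: "x \<in> A \<Longrightarrow> x \<in> ideal_gen A"
  unfolding ideal_gen_def by (rule module.span_base[OF module_mult])

lemma ideal_gen_zero: "0 \<in> ideal_gen A"
  unfolding ideal_gen_def by (rule module.span_zero[OF module_mult])

lemma ideal_gen_add: "x \<in> ideal_gen A \<Longrightarrow> y \<in> ideal_gen A \<Longrightarrow> x + y \<in> ideal_gen A"
  unfolding ideal_gen_def by (rule module.span_add[OF module_mult])

lemma ideal_gen_mult: "x \<in> ideal_gen A \<Longrightarrow> c * x \<in> ideal_gen A"
  unfolding ideal_gen_def by (rule module.span_scale[OF module_mult])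

lemma ideal_gen_mult_right: "x \<in> ideal_gen A \<Longrightarrow> x * c \<in> ideal_gen A"
  using ideal_gen_mult[of x A c] by (simp add: mult.commute)

lemma ideal_gen_sum: "(\<And>x. x \<in> T \<Longrightarrow> f x \<in> ideal_gen A) \<Longrightarrow> sum f T \<in> ideal_gen A"
  unfolding ideal_gen_def by (rule module.span_sum[OF module_mult])

lemma ideal_gen_induct [consumes 1, case_names zero step]:
  assumes "x \<in> ideal_gen A" "P 0" "\<And>c x y. x \<in> A \<Longrightarrow> P y \<Longrightarrow> P (c * x + y)"
  shows "P x"
  using assms unfolding ideal_gen_def by (rule module.span_induct_alt[OF module_mult])

lemma ideal_gen_subset:
  assumes "A \<subseteq> ideal_gen B"
  shows "ideal_gen A \<subseteq> ideal_gen B"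
proof
  fix x assume "x \<in> ideal_gen A"
  then show "x \<in> ideal_gen B"
    by (induction rule: ideal_gen_induct)
      (use assms in \<open>auto intro: ideal_gen_zero ideal_gen_add ideal_gen_mult\<close>)
qed

lemma ideal_mult_base: "f \<in> I \<Longrightarrow> g \<in> J \<Longrightarrow> f * g \<in> ideal_mult I J"
  unfolding ideal_mult_def by (rule ideal_gen_base) blast

lemma ideal_mult_gen: "ideal_mult (ideal_gen A) (ideal_gen B) = ideal_gen {a * b | a b. a \<in> A \<and> b \<in> B}"
  (is "_ = ideal_gen ?C")
proof
  have A: "a * g \<in> ideal_gen ?C" if "a \<in> A" "g \<in> ideal_gen B" for a g
    using that(2)
  proof (induction rule: ideal_gen_induct)
    case (step c x y)
    have "a * (c * x + y) = c * (a * x) + a * y"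
      by (simp add: algebra_simps)
    moreover have "a * x \<in> ideal_gen ?C"
      using step that by (intro ideal_gen_base) blast
    ultimately show ?case
      using step by (simp add: ideal_gen_add ideal_gen_mult)
  qed (simp add: ideal_gen_zero)
  have "f * g \<in> ideal_gen ?C" if "f \<in> ideal_gen A" "g \<in> ideal_gen B" for f g
    using that(1)
  proof (induction rule: ideal_gen_induct)
    case (step c x y)
    then show ?case
      using A[OF step(1) that(2)]
      by (simp add: distrib_right mult.assoc ideal_gen_add ideal_gen_mult)
  qed (simp add: ideal_gen_zero)
  then show "ideal_mult (ideal_gen A) (ideal_gen B) \<subseteq> ideal_gen ?C"
    unfolding ideal_mult_def by (intro ideal_gen_subset) blast
  show "ideal_gen ?C \<subseteq> ideal_mult (ideal_gen A) (ideal_gen B)"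
    unfolding ideal_mult_def
    by (intro ideal_gen_subset) (blast intro: ideal_gen_base)
qed

lemma monomial_mult: "monomial u * monomial v = monomial (u + v)"
  by (simp add: monomial_def mult_single)

lemma monomial_0: "monomial 0 = 1"
  by (simp add: monomial_def)

lemma keys_monomial: "Poly_Mapping.keys (monomial u :: ('n, 'k::field) mpoly) = {u}"
  by (simp add: monomial_def)

lemma ideal_mult_monomial:
  "ideal_mult (ideal_gen (monomial ` A)) (ideal_gen (monomial ` B)) =
    (ideal_gen (monomial ` sumset A B) :: ('n, 'k::field) mpoly set)"
proof -
  have "{a * b | a b. a \<in> monomial ` A \<and> b \<in> monomial ` B} =
      (monomial ` sumset A B :: ('n, 'k) mpoly set)"
  proof (intro equalityI subsetI)
    fix x :: "('n, 'k) mpoly"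
    assume "x \<in> {a * b | a b. a \<in> monomial ` A \<and> b \<in> monomial ` B}"
    then show "x \<in> monomial ` sumset A B"
      by (auto simp: monomial_mult intro: sumsetI)
  next
    fix x :: "('n, 'k) mpoly"
    assume "x \<in> monomial ` sumset A B"
    then obtain a b where "x = monomial a * monomial b" "a \<in> A" "b \<in> B"
      by (auto simp: monomial_mult elim!: sumsetE)
    then show "x \<in> {a * b | a b. a \<in> monomial ` A \<and> b \<in> monomial ` B}"
      by blast
  qed
  then show ?thesis
    by (simp add: ideal_mult_gen)
qed

lemma ideal_gen_one: "ideal_gen {1} = UNIV"
  using ideal_gen_mult[OF ideal_gen_base[of 1 "{1}"]] by auto

lemma ideal_power_monomial:
  "ideal_power (ideal_gen (monomial ` B)) k = ideal_gen (monomial ` multiple B k)"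
  by (induction k) (simp_all add: ideal_mult_monomial monomial_0 ideal_gen_one)

lemma upsetI: "g \<in> A \<Longrightarrow> g + w \<in> upset A"
  unfolding upset_def by blast

lemma upsetE:
  assumes "m \<in> upset A" obtains g w where "m = g + w" "g \<in> A"
  using assms unfolding upset_def by blast

lemma upset_add: "m \<in> upset A \<Longrightarrow> w + m \<in> upset (A :: 'a::ab_semigroup_add set)"
  by (metis upsetI upsetE add.assoc add.commute)

lemma upset_base: "m \<in> A \<Longrightarrow> m \<in> upset (A :: 'a::monoid_add set)"
  using upsetI[of m A 0] by simp

lemma single_eq_monomial_mult: "Poly_Mapping.single (u + v) c = Poly_Mapping.single u c * monomial v"
  by (simp add: monomial_def mult_single)

lemma sum_single_keys: "(\<Sum>m\<in>Poly_Mapping.keys f. Poly_Mapping.single m (Poly_Mapping.lookup f m)) = f"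
  by (rule poly_mapping_eqI)
    (simp add: lookup_sum lookup_single when_def in_keys_iff)

text \<open>Membership is decided term by term, which lets exponent sets stand in for
  ideals.\<close>

lemma in_monomial_ideal_iff:
  "f \<in> ideal_gen (monomial ` A) \<longleftrightarrow> Poly_Mapping.keys f \<subseteq> upset A"
  for f :: "('n, 'k::field) mpoly"
proof
  show "f \<in> ideal_gen (monomial ` A) \<Longrightarrow> Poly_Mapping.keys f \<subseteq> upset A"
  proof (induction rule: ideal_gen_induct)
    case (step c x y)
    then obtain a where a: "x = monomial a" "a \<in> A" by blast
    have "Poly_Mapping.keys (c * x) \<subseteq> {b + a | b. b \<in> Poly_Mapping.keys c}"
      using keys_mult[of c x] unfolding a keys_monomial by blast
    also have "\<dots> \<subseteq> upset A"
      using upset_add[OF upset_base[OF a(2)]] by blast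
    finally show ?case
      using step(2) keys_add[of "c * x" y] by blast
  qed simp
next
  assume *: "Poly_Mapping.keys f \<subseteq> upset A"
  have "Poly_Mapping.single m c \<in> ideal_gen (monomial ` A)" if m: "m \<in> upset A" for m and c :: 'k
  proof -
    obtain w a where "m = w + a" "a \<in> A"
      using upsetE[OF m] add.commute by metis
    then show ?thesis
      unfolding \<open>m = w + a\<close> single_eq_monomial_mult by (intro ideal_gen_mult ideal_gen_base) blast
  qed
  then have "(\<Sum>m\<in>Poly_Mapping.keys f. Poly_Mapping.single m (Poly_Mapping.lookup f m)) \<in> ideal_gen (monomial ` A)"
    using * by (intro ideal_gen_sum) blast
  then show "f \<in> ideal_gen (monomial ` A)"
    by (simp add: sum_single_keys)
qed

lemma monomial_ideal_eq_iff:
  "ideal_gen (monomial ` A) = (ideal_gen (monomial ` B) :: ('n, 'k::field) mpoly set) \<longleftrightarrow>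
    upset A = upset B"
proof
  assume eq: "ideal_gen (monomial ` A) = (ideal_gen (monomial ` B) :: ('n, 'k) mpoly set)"
  have "m \<in> upset A \<longleftrightarrow> m \<in> upset B" for m
    using in_monomial_ideal_iff[of "monomial m :: ('n, 'k) mpoly" A]
      in_monomial_ideal_iff[of "monomial m :: ('n, 'k) mpoly" B] eq
    by (simp add: keys_monomial)
  then show "upset A = upset B" by blast
next
  assume "upset A = upset B"
  then show "ideal_gen (monomial ` A) = (ideal_gen (monomial ` B) :: ('n, 'k) mpoly set)"
    using in_monomial_ideal_iff by blast
qed

lemma upset_idem: "upset (upset A) = upset (A :: 'a::monoid_add set)"
  by (auto elim!: upsetE simp: add.assoc intro: upsetI upset_base)

lemma upset_mono: "A \<subseteq> B \<Longrightarrow> upset A \<subseteq> upset B"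
  unfolding upset_def by blast

section \<open>Minimal generators of a monomial ideal\<close>

definition minimal_exponents :: "('n \<Rightarrow>\<^sub>0 nat) set \<Rightarrow> ('n \<Rightarrow>\<^sub>0 nat) set"
  where "minimal_exponents A = {m \<in> A. \<forall>g w. g \<in> A \<longrightarrow> m = g + w \<longrightarrow> w = 0}"

lemma upset_minimal_exponents:
  fixes A :: "('n::finite \<Rightarrow>\<^sub>0 nat) set"
  shows "upset (minimal_exponents A) = upset A"
proof
  show "upset (minimal_exponents A) \<subseteq> upset A"
    by (rule upset_mono) (auto simp: minimal_exponents_def)
  have "m \<in> A \<Longrightarrow> m \<in> upset (minimal_exponents A)" for m
  proof (induction "total_deg m" arbitrary: m rule: less_induct)
    case less
    show ?case
    proof (cases "m \<in> minimal_exponents A")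
      case True
      then show ?thesis by (rule upset_base)
    next
      case False
      then obtain g w where "g \<in> A" "m = g + w" "w \<noteq> 0"
        using less.prems unfolding minimal_exponents_def by blast
      then show ?thesis
        using less.hyps[of g] upset_add[of g _ w] total_deg_eq_0[of w]
        by (simp add: total_deg_add add.commute)
    qed
  qed
  then have "A \<subseteq> upset (minimal_exponents A)" by blast
  from upset_mono[OF this] show "upset A \<subseteq> upset (minimal_exponents A)"
    by (simp add: upset_idem)
qed

text \<open>A minimal \<open>m\<close> equals any member of \<open>H\<close> dividing it. Hence
  every generating set contains the minimal exponents, which justifies the definite description in
  \<open>min_gens\<close>.\<close>

lemma minimal_exponents_least:
  fixes H :: "('n \<Rightarrow>\<^sub>0 nat) set"
  assumes "upset H = upset A"
  shows "minimal_exponents (upset A) \<subseteq> H"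
proof
  fix m assume m: "m \<in> minimal_exponents (upset A)"
  then obtain g w where "m = g + w" "g \<in> H"
    using assms unfolding minimal_exponents_def upset_def by blast
  moreover from this have "g \<in> upset A"
    using upset_base assms by blast
  ultimately show "m \<in> H"
    using m unfolding minimal_exponents_def by auto
qed

lemma ideal_gen_min_gens:
  fixes J :: "('n::finite, 'k::field) mpoly set"
  assumes "monomial_ideal J"
  shows "ideal_gen (monomial ` min_gens J) = J"
proof -
  obtain A where J: "J = ideal_gen (monomial ` A)"
    using assms by (auto simp: monomial_ideal_def)
  have "min_gens J = minimal_exponents (upset A)"
    unfolding min_gens_def J monomial_ideal_eq_iff
  proof (rule the_equality)
    show "upset (minimal_exponents (upset A)) = upset A \<and>
        (\<forall>H. H \<subset> minimal_exponents (upset A) \<longrightarrow> upset H \<noteq> upset A)"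
      using minimal_exponents_least by (auto simp: upset_minimal_exponents upset_idem)
  next
    fix G assume "upset G = upset A \<and> (\<forall>H. H \<subset> G \<longrightarrow> upset H \<noteq> upset A)"
    then show "G = minimal_exponents (upset A)"
      using minimal_exponents_least[of G A] upset_minimal_exponents[of "upset A"]
      by (auto simp: upset_idem psubset_eq)
  qed
  then show ?thesis
    by (simp add: J monomial_ideal_eq_iff upset_minimal_exponents upset_idem)
qed

lemma polymatroidal_imp_bases:
  fixes I :: "('n::finite, 'k::field) mpoly set"
  assumes "polymatroidal I"
  obtains d B where "I = ideal_gen (monomial ` B)" "polymatroid_bases d B"
proof
  show "I = ideal_gen (monomial ` min_gens I)"
    using assms ideal_gen_min_gens unfolding polymatroidal_def by blast
  \<comment> \<open>All minimal generators have one degree, so whichever generator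
    \<open>SOME\<close> picks provides \<open>d\<close>.\<close>
  show "polymatroid_bases (total_deg (SOME u. u \<in> min_gens I)) (min_gens I)"
    using assms unfolding polymatroidal_def polymatroid_bases_def One_nat_def
    by (metis someI)
qed

section \<open>Homogeneous polynomials\<close>

abbreviation coef :: "('n, 'k::field) mpoly \<Rightarrow> ('n \<Rightarrow>\<^sub>0 nat) \<Rightarrow> 'k"
  where "coef \<equiv> Poly_Mapping.lookup"

lemma coef_single_mult:
  fixes g :: "('n, 'k::field) mpoly"
  shows "coef (Poly_Mapping.single m c * g) (m + l) = c * coef g l"
proof -
  have "Poly_Mapping.single m c * g =
      (\<Sum>k\<in>Poly_Mapping.keys g. Poly_Mapping.single (m + k) (c * coef g k))"
    by (subst sum_single_keys[of g, symmetric]) (simp add: sum_distrib_left mult_single)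
  then show ?thesis
    by (simp add: lookup_sum lookup_single when_def in_keys_iff)
qed

lemma coef_single_mult_other:
  fixes g :: "('n, 'k::field) mpoly"
  assumes "\<And>l. k \<noteq> m + l"
  shows "coef (Poly_Mapping.single m c * g) k = 0"
proof (rule ccontr)
  assume "coef (Poly_Mapping.single m c * g) k \<noteq> 0"
  then have "k \<in> Poly_Mapping.keys (Poly_Mapping.single m c * g)"
    by (simp add: in_keys_iff)
  then show False
    using keys_mult[of "Poly_Mapping.single m c" g] assms by (auto split: if_splits)
qed

lemma exponent_add_eq_0: "u + v = 0 \<longleftrightarrow> u = 0 \<and> v = 0" for u v :: "'n \<Rightarrow>\<^sub>0 nat"
proof
  assume "u + v = 0"
  then have "Poly_Mapping.lookup u k = 0 \<and> Poly_Mapping.lookup v k = 0" for k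
    by (metis add_eq_0_iff_both_eq_0 lookup_add lookup_zero)
  then show "u = 0 \<and> v = 0"
    by (simp add: poly_mapping_eq_iff fun_eq_iff)
qed simp

lemma coef_mult_0:
  fixes f g :: "('n, 'k::field) mpoly"
  shows "coef (f * g) 0 = coef f 0 * coef g 0"
proof -
  have *: "coef (Poly_Mapping.single m c * g) 0 = (if m = 0 then c * coef g 0 else 0)" for m c
    using coef_single_mult[of 0 c g 0] coef_single_mult_other[of 0 m c g] exponent_add_eq_0[of m]
    by (metis add.right_neutral)
  have "f * g = (\<Sum>m\<in>Poly_Mapping.keys f. Poly_Mapping.single m (coef f m) * g)"
    by (subst sum_single_keys[of f, symmetric]) (simp add: sum_distrib_right)
  then show ?thesis
    by (simp add: lookup_sum * in_keys_iff)
qed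

lemma has_degree_mult:
  assumes "has_degree a f" "has_degree b g"
  shows "has_degree (\<lambda>j. a j + b j) (f * g)"
  unfolding has_degree_def
proof (intro ballI allI)
  fix m j assume "m \<in> Poly_Mapping.keys (f * g)"
  then obtain u v where "m = u + v" "u \<in> Poly_Mapping.keys f" "v \<in> Poly_Mapping.keys g"
    using keys_mult[of f g] by blast
  with assms show "int (Poly_Mapping.lookup m j) = a j + b j"
    by (simp add: has_degree_def lookup_add)
qed

lemma has_degree_add: "has_degree a f \<Longrightarrow> has_degree a g \<Longrightarrow> has_degree a (f + g)"
  unfolding has_degree_def using keys_add[of f g] by blast

lemma has_degree_zero: "has_degree a 0"
  by (simp add: has_degree_def)

lemma has_degree_sum: "(\<And>t. t \<in> T \<Longrightarrow> has_degree a (f t)) \<Longrightarrow> has_degree a (\<Sum>t\<in>T. f t)"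
  by (induction T rule: infinite_finite_induct) (simp_all add: has_degree_zero has_degree_add)

lemma has_degree_single: "has_degree (\<lambda>j. int (Poly_Mapping.lookup m j)) (Poly_Mapping.single m c)"
  by (simp add: has_degree_def)

text \<open>Each degree of the fine grading contains at most one monomial.\<close>

lemma has_degree_imp_single:
  assumes "has_degree a f" "m \<in> Poly_Mapping.keys f"
  shows "f = Poly_Mapping.single m (coef f m)"
proof (rule poly_mapping_eqI)
  fix k
  have "k = m" if "k \<in> Poly_Mapping.keys f"
  proof (rule poly_mapping_eqI)
    fix j
    have "int (Poly_Mapping.lookup k j) = int (Poly_Mapping.lookup m j)"
      using assms that by (simp add: has_degree_def)
    then show "Poly_Mapping.lookup k j = Poly_Mapping.lookup m j" by simp
  qed
  then show "coef f k = coef (Poly_Mapping.single m (coef f m)) k"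
    by (auto simp: lookup_single when_def in_keys_iff)
qed

lemma keys_nonempty: "f \<noteq> 0 \<Longrightarrow> \<exists>m. m \<in> Poly_Mapping.keys f"
  by (metis in_keys_iff lookup_zero poly_mapping_eqI)

text \<open>The degree is integral because differences with shifts may be negative; the part is then
  0.\<close>

definition hom_part :: "('n \<Rightarrow> int) \<Rightarrow> ('n, 'k::field) mpoly \<Rightarrow> ('n, 'k) mpoly"
  where "hom_part a f = (\<Sum>m | m \<in> Poly_Mapping.keys f \<and> (\<forall>j. int (Poly_Mapping.lookup m j) = a j).
    Poly_Mapping.single m (coef f m))"

lemma coef_hom_part:
  "coef (hom_part a f) m = (if \<forall>j. int (Poly_Mapping.lookup m j) = a j then coef f m else 0)"
proof -
  have "finite {m \<in> Poly_Mapping.keys f. \<forall>j. int (Poly_Mapping.lookup m j) = a j}"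
    by (rule finite_subset[OF _ finite_keys[of f]]) blast
  then show ?thesis
    by (simp add: hom_part_def lookup_sum lookup_single when_def in_keys_iff)
qed

lemma keys_hom_part: "Poly_Mapping.keys (hom_part a f) \<subseteq> Poly_Mapping.keys f"
  by (auto simp: in_keys_iff coef_hom_part split: if_splits)

lemma has_degree_hom_part: "has_degree a (hom_part a f)"
  by (auto simp: has_degree_def in_keys_iff coef_hom_part split: if_splits)

lemma hom_part_add: "hom_part a (f + g) = hom_part a f + hom_part a g"
  by (rule poly_mapping_eqI) (simp add: coef_hom_part lookup_add)

lemma hom_part_sum: "hom_part a (\<Sum>t\<in>T. f t) = (\<Sum>t\<in>T. hom_part a (f t))"
  by (rule poly_mapping_eqI) (auto simp: coef_hom_part lookup_sum intro!: sum.neutral)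

lemma hom_part_id: "has_degree a f \<Longrightarrow> hom_part a f = f"
  by (rule poly_mapping_eqI) (auto simp: coef_hom_part has_degree_def in_keys_iff)

lemma hom_part_mult:
  assumes g: "has_degree b g"
  shows "hom_part a (f * g) = hom_part (\<lambda>j. a j - b j) f * g"
proof -
  define r where "r = f - hom_part (\<lambda>j. a j - b j) f"
  have r: "\<not> (\<forall>j. int (Poly_Mapping.lookup m j) = a j - b j)" if "m \<in> Poly_Mapping.keys r" for m
    using that by (auto simp: r_def in_keys_iff lookup_minus coef_hom_part split: if_splits)
  have "hom_part a (r * g) = 0"
  proof (rule poly_mapping_eqI, rule ccontr)
    fix k assume "coef (hom_part a (r * g)) k \<noteq> coef 0 k"
    then have k: "k \<in> Poly_Mapping.keys (r * g)" "\<forall>j. int (Poly_Mapping.lookup k j) = a j"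
      by (auto simp: coef_hom_part in_keys_iff split: if_splits)
    then obtain u v where uv: "k = u + v" "u \<in> Poly_Mapping.keys r" "v \<in> Poly_Mapping.keys g"
      using keys_mult[of r g] by blast
    then have "int (Poly_Mapping.lookup u j) = a j - b j" for j
      using k(2) g by (metis add_diff_cancel_right' has_degree_def lookup_add of_nat_add)
    with r[OF uv(2)] show False by blast
  qed
  moreover have "has_degree a (hom_part (\<lambda>j. a j - b j) f * g)"
    using has_degree_mult[OF has_degree_hom_part g, of "\<lambda>j. a j - b j" f] by simp
  moreover have "f * g = hom_part (\<lambda>j. a j - b j) f * g + r * g"
    by (simp add: r_def algebra_simps)
  ultimately show ?thesis
    by (simp add: hom_part_add hom_part_id)
qed

section \<open>Tor of a monomial ideal from an arbitrary resolution\<close>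

lemma bd_sum:
  "bd F i (\<lambda>b. \<Sum>t\<in>T. r t * y t b) = (\<lambda>c. \<Sum>t\<in>T. r t * bd F i (y t) c)"
proof
  fix c
  have "(\<Sum>b\<in>gens F (Suc i). (\<Sum>t\<in>T. r t * y t b) * diff F i b c) =
      (\<Sum>b\<in>gens F (Suc i). \<Sum>t\<in>T. r t * (y t b * diff F i b c))"
    by (simp add: sum_distrib_right mult.assoc)
  also have "\<dots> = (\<Sum>t\<in>T. r t * (\<Sum>b\<in>gens F (Suc i). y t b * diff F i b c))"
    by (subst sum.swap) (simp add: sum_distrib_left)
  finally show "bd F i (\<lambda>b. \<Sum>t\<in>T. r t * y t b) c = (\<Sum>t\<in>T. r t * bd F i (y t) c)"
    by (simp add: bd_def)
qed

lemma bd_mult: "bd F i (\<lambda>b. r * y b) = (\<lambda>c. r * bd F i y c)"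
  by (simp add: bd_def fun_eq_iff mult.assoc sum_distrib_left)

lemma bd_diff: "bd F i (\<lambda>b. y b - y' b) = (\<lambda>c. bd F i y c - bd F i y' c)"
  by (simp add: bd_def fun_eq_iff left_diff_distrib sum_subtractf)

lemma aug_map_diff: "aug_map F (\<lambda>b. y b - y' b) = aug_map F y - aug_map F y'"
  by (simp add: aug_map_def lookup_minus left_diff_distrib sum_subtractf)

lemma aug_map_mult: "aug_map F (\<lambda>b. r * y b) = coef r 0 * aug_map F y"
  by (simp add: aug_map_def coef_mult_0 mult.assoc sum_distrib_left)

definition basis_chain :: "nat \<Rightarrow> nat \<Rightarrow> ('n, 'k::field) mpoly"
  where "basis_chain b = (\<lambda>c. if c = b then 1 else 0)"

lemma basis_chain_in: "b \<in> gens F i \<Longrightarrow> basis_chain b \<in> chains_of F UNIV i"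
  by (auto simp: chains_of_def basis_chain_def)

lemma sum_basis_chain_mult:
  assumes "finite G"
  shows "(\<Sum>c\<in>G. basis_chain b c * f c) = (if b \<in> G then f b else 0)"
proof -
  have "(\<Sum>c\<in>G. basis_chain b c * f c) = (\<Sum>c\<in>G. if c = b then f c else 0)"
    by (rule sum.cong) (simp_all add: basis_chain_def)
  then show ?thesis using assms by simp
qed

lemma sum_mult_basis_chain:
  assumes "finite G"
  shows "(\<Sum>b\<in>G. f b * basis_chain b c) = (if c \<in> G then f c else 0)"
proof -
  have "(\<Sum>b\<in>G. f b * basis_chain b c) = (\<Sum>b\<in>G. if c = b then f b else 0)"
    by (rule sum.cong) (simp_all add: basis_chain_def)
  then show ?thesis using assms by simp
qed

lemma bd_basis_chain:
  assumes "finite (gens F (Suc i))" "b \<in> gens F (Suc i)"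
  shows "bd F i (basis_chain b) = (\<lambda>c. if c \<in> gens F i then diff F i b c else 0)"
  using assms by (simp add: bd_def fun_eq_iff sum_basis_chain_mult)

lemma aug_map_basis_chain:
  assumes "finite (gens F 0)" "c \<in> gens F 0"
  shows "aug_map F (basis_chain c) = aug F c"
proof -
  have "aug_map F (basis_chain c) = (\<Sum>b\<in>gens F 0. if b = c then aug F b else 0)"
    unfolding aug_map_def by (rule sum.cong) (simp_all add: basis_chain_def)
  then show ?thesis using assms by simp
qed

text \<open>Degrees are ignored here so that boundaries can be combined freely;
  \<open>boundary_homogeneous\<close> restores them.\<close>

definition is_boundary :: "('n, 'k::field) free_seq \<Rightarrow> ('n, 'k) mpoly set \<Rightarrow> (nat \<Rightarrow> ('n, 'k) mpoly) \<Rightarrow> bool"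
  where "is_boundary F J v \<longleftrightarrow> (\<exists>w\<in>chains_of F J 2. v = bd F 1 w)"

lemma chains_of_ideal_sum:
  assumes "\<And>t. t \<in> T \<Longrightarrow> y t \<in> chains_of F (ideal_gen A) i"
  shows "(\<lambda>b. \<Sum>t\<in>T. r t * y t b) \<in> chains_of F (ideal_gen A) i"
  using assms by (auto simp: chains_of_def intro!: ideal_gen_sum ideal_gen_mult sum.neutral)

lemma is_boundary_sum:
  assumes "\<And>t. t \<in> T \<Longrightarrow> is_boundary F (ideal_gen A) (y t)"
  shows "is_boundary F (ideal_gen A) (\<lambda>b. \<Sum>t\<in>T. r t * y t b)"
proof -
  obtain w where w: "\<And>t. t \<in> T \<Longrightarrow> w t \<in> chains_of F (ideal_gen A) 2 \<and> y t = bd F 1 (w t)"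
    using assms unfolding is_boundary_def by metis
  then have "(\<lambda>b. \<Sum>t\<in>T. r t * y t b) = bd F 1 (\<lambda>b. \<Sum>t\<in>T. r t * w t b)"
    by (simp add: bd_sum)
  then show ?thesis
    using w chains_of_ideal_sum[of T w F A 2 r] unfolding is_boundary_def by blast
qed

lemma is_boundary_add:
  assumes "is_boundary F (ideal_gen A) y" "is_boundary F (ideal_gen A) y'"
  shows "is_boundary F (ideal_gen A) (\<lambda>b. y b + y' b)"
  using is_boundary_sum[of "UNIV :: bool set" F A "\<lambda>t. if t then y else y'" "\<lambda>_. 1"] assms
  by (simp add: UNIV_bool add.commute)

lemma is_boundary_zero: "is_boundary F (ideal_gen A) (\<lambda>_. 0)"
  using is_boundary_sum[of "{}" F A] by simp

lemma resolution_exact_0: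
  assumes "graded_free_resolution F"
  shows "bd F 0 ` chains_of F UNIV 1 = {v \<in> chains_of F UNIV 0. aug_map F v = 0}"
  using assms by (simp add: graded_free_resolution_def)

lemma resolution_exact_1:
  assumes "graded_free_resolution F"
  shows "bd F 1 ` chains_of F UNIV 2 = {v \<in> chains_of F UNIV 1. bd F 0 v = (\<lambda>_. 0)}"
proof -
  have "bd F (Suc 0) ` chains_of F UNIV (0 + 2) =
      {v \<in> chains_of F UNIV (Suc 0). bd F 0 v = (\<lambda>_. 0)}"
    using assms unfolding graded_free_resolution_def by blast
  then show ?thesis by (simp only: add_0 One_nat_def)
qed

text \<open>Exactness provides a preimage over S, and multiplication by \<open>r\<close> moves it
  into F_2 tensored with the ideal. All nonzero boundaries in \<open>cycle_is_boundary\<close> are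
  built from these.\<close>

lemma is_boundary_cycle:
  assumes F: "graded_free_resolution F" and y: "y \<in> chains_of F UNIV 1" "bd F 0 y = (\<lambda>_. 0)"
    and r: "r \<in> ideal_gen A"
  shows "is_boundary F (ideal_gen A) (\<lambda>b. r * y b)"
proof -
  obtain w where w: "w \<in> chains_of F UNIV 2" "y = bd F 1 w"
    using resolution_exact_1[OF F] y by blast
  then have "(\<lambda>b. r * w b) \<in> chains_of F (ideal_gen A) 2"
    using r by (auto simp: chains_of_def intro: ideal_gen_mult_right)
  moreover have "(\<lambda>b. r * y b) = bd F 1 (\<lambda>b. r * w b)"
    by (simp add: w(2) bd_mult)
  ultimately show ?thesis unfolding is_boundary_def by blast
qed

text \<open>Taking degree parts commutes with the homogeneous differential and preserves a monomial
  ideal, so a preimage may be replaced by its part of degree \<open>a\<close>.\<close>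

lemma boundary_homogeneous:
  assumes F: "graded_free_resolution F"
    and v: "v \<in> chains_at F (ideal_gen (monomial ` A)) 1 a"
    and bdry: "is_boundary F (ideal_gen (monomial ` A)) v"
  shows "v \<in> boundaries_at F (ideal_gen (monomial ` A)) 1 a"
proof -
  obtain w where w: "w \<in> chains_of F (ideal_gen (monomial ` A)) 2" "v = bd F 1 w"
    using bdry unfolding is_boundary_def by blast
  define w' where "w' b = (if b \<in> gens F 2 then hom_part (\<lambda>j. a j - shift F 2 b j) (w b) else 0)" for b
  have "w' \<in> chains_at F (ideal_gen (monomial ` A)) (Suc 1) a"
    using w(1) keys_hom_part unfolding chains_at_def chains_of_def w'_def numeral_2_eq_2
    by (fastforce simp: in_monomial_ideal_iff has_degree_hom_part)
  moreover have "bd F 1 w' = v"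
  proof
    fix c
    show "bd F 1 w' c = v c"
    proof (cases "c \<in> gens F 1")
      case True
      have deg: "has_degree (\<lambda>j. shift F 2 b j - shift F 1 c j) (diff F 1 b c)" if "b \<in> gens F 2" for b
        using F that True by (simp add: graded_free_resolution_def numeral_2_eq_2)
      have "w' b * diff F 1 b c = hom_part (\<lambda>j. a j - shift F 1 c j) (w b * diff F 1 b c)"
        if "b \<in> gens F 2" for b
      proof -
        have "(\<lambda>j. a j - shift F 2 b j) = (\<lambda>j. a j - shift F 1 c j - (shift F 2 b j - shift F 1 c j))"
          by (simp add: fun_eq_iff)
        then show ?thesis
          using that hom_part_mult[OF deg[OF that], of "\<lambda>j. a j - shift F 1 c j" "w b"]
          by (simp add: w'_def)
      qed
      then have "bd F 1 w' c = hom_part (\<lambda>j. a j - shift F 1 c j) (bd F 1 w c)"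
        using True by (simp add: bd_def hom_part_sum numeral_2_eq_2)
      also have "\<dots> = v c"
        unfolding w(2)[symmetric] using v True by (simp add: chains_at_def hom_part_id)
      finally show ?thesis .
    next
      case False
      then show ?thesis using v by (simp add: bd_def chains_at_def chains_of_def)
    qed
  qed
  ultimately show ?thesis
    unfolding boundaries_at_def by blast
qed

text \<open>\<open>tor_nonzero\<close> only says that two sets differ; with this inclusion, it
  suffices for vanishing that cycles are boundaries.\<close>

lemma boundaries_subset_cycles:
  assumes F: "graded_free_resolution F"
  shows "boundaries_at F (ideal_gen A) 1 a \<subseteq> cycles_at F (ideal_gen A) 1 a"
proof
  fix v assume "v \<in> boundaries_at F (ideal_gen A) 1 a"
  then obtain w where w: "w \<in> chains_at F (ideal_gen A) 2 a" "v = bd F 1 w"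
    by (auto simp: boundaries_at_def numeral_2_eq_2)
  have "has_degree (\<lambda>j. a j - shift F 1 c j) (v c)" if c: "c \<in> gens F 1" for c
    unfolding w(2) bd_def if_P[OF c]
  proof (rule has_degree_sum)
    fix b assume b: "b \<in> gens F (Suc 1)"
    have "has_degree (\<lambda>j. a j - shift F (Suc 1) b j + (shift F (Suc 1) b j - shift F 1 c j)) (w b * diff F 1 b c)"
      using w(1) b c F by (intro has_degree_mult)
        (auto simp: chains_at_def graded_free_resolution_def numeral_2_eq_2)
    then show "has_degree (\<lambda>j. a j - shift F 1 c j) (w b * diff F 1 b c)" by simp
  qed
  moreover have "v \<in> chains_of F (ideal_gen A) 1"
    using w by (auto simp: chains_at_def chains_of_def bd_def numeral_2_eq_2
        intro!: ideal_gen_sum ideal_gen_mult_right)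
  moreover have "bd F 0 v = (\<lambda>_. 0)"
  proof -
    have "w \<in> chains_of F UNIV 2"
      using w(1) by (simp add: chains_at_def chains_of_def)
    then show ?thesis
      unfolding w(2) using resolution_exact_1[OF F] by blast
  qed
  ultimately show "v \<in> cycles_at F (ideal_gen A) 1 a"
    by (simp add: cycles_at_def chains_at_def)
qed

text \<open>
  With \<open>u\<close> of augmentation \<open>1\<close>, a cycle \<open>v = \<Sum> v\<^sub>b b\<close> is modulo boundaries a combination, with
  coefficients adding up to \<open>0\<close>, of the chains \<open>x\<^sup>a / x\<^sub>i \<cdot> z\<^sub>i\<close>, where \<open>z\<^sub>i\<close> is a chain in \<open>F\<^sub>1\<close> with
  boundary \<open>x\<^sub>i u\<close>. An edge \<open>{i, j}\<close> gives the boundary \<open>x\<^sup>a / (x\<^sub>i x\<^sub>j) \<cdot> (x\<^sub>j z\<^sub>i - x\<^sub>i z\<^sub>j)\<close>.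
\<close>

lemma cycle_is_boundary:
  fixes A :: "('n \<Rightarrow>\<^sub>0 nat) set" and F :: "('n, 'k::field) free_seq"
  defines "J \<equiv> ideal_gen (monomial ` A)"
  assumes F: "graded_free_resolution F"
    and v: "v \<in> chains_at F J 1 (\<lambda>j. int (Poly_Mapping.lookup a j))" and cyc: "bd F 0 v = (\<lambda>_. 0)"
    and conn: "\<And>i j. koszul_vertex (upset A) a i \<Longrightarrow> koszul_vertex (upset A) a j \<Longrightarrow>
      (koszul_edge (upset A) a)\<^sup>*\<^sup>* i j"
  shows "is_boundary F J v"
proof -
  define C :: "'k \<Rightarrow> ('n, 'k) mpoly" where "C = Poly_Mapping.single 0"
  have fin: "finite (gens F i)" for i
    using F by (simp add: graded_free_resolution_def)
  have vJ: "v b \<in> J" if "b \<in> gens F 1" for b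
    using v that by (simp add: chains_at_def chains_of_def)
  have lift: "\<exists>z\<in>chains_of F UNIV 1. bd F 0 z = y"
    if "y \<in> chains_of F UNIV 0" "aug_map F y = 0" for y
  proof -
    have "y \<in> bd F 0 ` chains_of F UNIV 1"
      using that unfolding resolution_exact_0[OF F] by simp
    then show ?thesis by blast
  qed
  obtain u where u: "u \<in> chains_of F UNIV 0" "aug_map F u = 1"
  proof -
    have "aug_map F ` chains_of F UNIV 0 = UNIV"
      using F by (simp add: graded_free_resolution_def)
    then have "1 \<in> aug_map F ` chains_of F UNIV 0" by simp
    then show thesis using that by auto
  qed
  have "\<exists>z\<in>chains_of F UNIV 1. bd F 0 z = (\<lambda>d. basis_chain c d - C (aug F c) * u d)"
    if c: "c \<in> gens F 0" for c
  proof (rule lift)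
    show "(\<lambda>d. basis_chain c d - C (aug F c) * u d) \<in> chains_of F UNIV 0"
      using basis_chain_in[OF c] u(1) by (simp add: chains_of_def)
    show "aug_map F (\<lambda>d. basis_chain c d - C (aug F c) * u d) = 0"
      using u(2) by (simp add: aug_map_diff aug_map_mult aug_map_basis_chain[OF fin c] C_def)
  qed
  \<comment> \<open>Modulo boundaries, a basis element \<open>c\<close> of F_0 is
    \<open>aug F c\<close> times \<open>u\<close>; \<open>z c\<close> records this.\<close>
  then obtain z where z: "\<And>c. c \<in> gens F 0 \<Longrightarrow> z c \<in> chains_of F UNIV 1 \<and>
      bd F 0 (z c) = (\<lambda>d. basis_chain c d - C (aug F c) * u d)"
    by metis
  have "\<exists>z\<in>chains_of F UNIV 1. bd F 0 z = (\<lambda>d. monomial (var i) * u d)" for i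
  proof (rule lift)
    show "(\<lambda>d. monomial (var i) * u d) \<in> chains_of F UNIV 0"
      using u(1) by (simp add: chains_of_def)
    have "var i \<noteq> 0"
      by (metis lookup_single_eq lookup_zero n_not_Suc_n)
    then show "aug_map F (\<lambda>d. monomial (var i) * u d) = 0"
      by (simp add: aug_map_mult monomial_def lookup_single when_def)
  qed
  \<comment> \<open>\<open>x i\<close> is the chain called \<open>z\<^sub>i\<close> in the comment
    above the lemma, not one of the \<open>z c\<close>.\<close>
  then obtain x where x: "\<And>i. x i \<in> chains_of F UNIV 1"
      "\<And>i. bd F 0 (x i) = (\<lambda>d. monomial (var i) * u d)"
    by metis
  \<comment> \<open>The boundary of the basis element \<open>b\<close> is \<open>p b * u\<close> up
    to a combination of the boundaries of the \<open>z c\<close>.\<close>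
  define p where "p b = (\<Sum>c\<in>gens F 0. diff F 0 b c * C (aug F c))" for b
  \<comment> \<open>\<open>p b\<close> has no constant term because boundaries augment to 0, and it
    is homogeneous because \<open>aug F c\<close> is nonzero only in degree 0. So it is a single
    term, divisible by some variable.\<close>
  have factor: "\<forall>b\<in>gens F 1. \<exists>i q. p b = q * monomial (var i) \<and>
    has_degree (\<lambda>j. shift F 1 b j - (if j = i then 1 else 0)) q"
  proof
    fix b assume b: "b \<in> gens F 1"
    show "\<exists>i q. p b = q * monomial (var i) \<and>
      has_degree (\<lambda>j. shift F 1 b j - (if j = i then 1 else 0)) q"
    proof (cases "p b = 0")
      case True
      \<comment> \<open>With \<open>q = 0\<close> any variable will do, hence
        \<open>undefined\<close>.\<close>
      then show ?thesis
        by (intro exI[of _ undefined] exI[of _ 0]) (simp add: has_degree_zero)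
    next
      case False
      then obtain n where n: "n \<in> Poly_Mapping.keys (p b)" using keys_nonempty by blast
      have deg: "has_degree (shift F 1 b) (p b)"
        unfolding p_def
      proof (rule has_degree_sum)
        fix c assume c: "c \<in> gens F 0"
        have d: "has_degree (\<lambda>j. shift F 1 b j - shift F 0 c j) (diff F 0 b c)"
          using F b c by (simp add: graded_free_resolution_def)
        show "has_degree (shift F 1 b) (diff F 0 b c * C (aug F c))"
        proof (cases "aug F c = 0")
          case True
          then show ?thesis by (simp add: C_def has_degree_zero)
        next
          case False
          then have "shift F 0 c = (\<lambda>_. 0)"
            using F c by (simp add: graded_free_resolution_def)
          then show ?thesis
            using has_degree_mult[OF d has_degree_single[of 0 "aug F c"]] by (simp add: C_def)
        qed
      qed
      have "aug_map F (bd F 0 (basis_chain b)) = 0"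
        using resolution_exact_0[OF F] basis_chain_in[OF b] by blast
      moreover have "aug_map F (bd F 0 (basis_chain b)) = coef (p b) 0"
        using bd_basis_chain[OF fin, of b 0] b
        by (simp add: p_def aug_map_def lookup_sum coef_mult_0 C_def)
      ultimately have "n \<noteq> 0"
        using n by (auto simp: in_keys_iff)
      then obtain i where "Poly_Mapping.lookup n i > 0"
        by (metis gr0I lookup_zero poly_mapping_eqI)
      then obtain n' where n': "n = n' + var i" by (rule ex_var_add)
      define q where "q = Poly_Mapping.single n' (coef (p b) n)"
      have "p b = q * monomial (var i)"
        using has_degree_imp_single[OF deg n] by (simp add: q_def monomial_def mult_single n')
      moreover have "has_degree (\<lambda>j. shift F 1 b j - (if j = i then 1 else 0)) q"
      proof -
        have "shift F 1 b j = int (Poly_Mapping.lookup (n' + var i) j)" for j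
          using deg n unfolding has_degree_def n' by simp
        then show ?thesis
          by (auto simp: has_degree_def q_def lookup_add lookup_var)
      qed
      ultimately show ?thesis by blast
    qed
  qed
  obtain i where i: "\<forall>b\<in>gens F 1. \<exists>q. p b = q * monomial (var (i b)) \<and>
      has_degree (\<lambda>j. shift F 1 b j - (if j = i b then 1 else 0)) q"
    using bchoice[OF factor] by blast
  obtain q where q: "\<And>b. b \<in> gens F 1 \<Longrightarrow> p b = q b * monomial (var (i b))"
    and degq: "\<And>b. b \<in> gens F 1 \<Longrightarrow> has_degree (\<lambda>j. shift F 1 b j - (if j = i b then 1 else 0)) (q b)"
    using bchoice[OF i] by blast
  \<comment> \<open>By degree, \<open>v b * q b\<close> is the scalar \<open>l b\<close> times x^a
    divided by the variable \<open>i b\<close>. If \<open>l b = 0\<close>, that variable need not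
    divide x^a, so the claim about vertices is conditional.\<close>
  define l where "l b = coef (v b * q b) (a - var (i b))" for b
  have vq: "v b * q b = C (l b) * monomial (a - var (i b)) \<and>
      (l b \<noteq> 0 \<longrightarrow> koszul_vertex (upset A) a (i b) \<and> a = a - var (i b) + var (i b))"
    if b: "b \<in> gens F 1" for b
  proof (cases "v b * q b = 0")
    case True
    then show ?thesis by (simp add: l_def C_def)
  next
    case False
    then obtain m where m: "m \<in> Poly_Mapping.keys (v b * q b)" using keys_nonempty by blast
    have "has_degree (\<lambda>j. int (Poly_Mapping.lookup a j) - shift F 1 b j) (v b)"
      using v b by (simp add: chains_at_def)
    from has_degree_mult[OF this degq[OF b]]
    have deg: "has_degree (\<lambda>j. int (Poly_Mapping.lookup a j) - (if j = i b then 1 else 0)) (v b * q b)"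
      by (simp add: algebra_simps)
    have am: "a = m + var (i b)"
    proof (rule poly_mapping_eqI)
      fix j
      have "int (Poly_Mapping.lookup m j) = int (Poly_Mapping.lookup a j) - (if j = i b then 1 else 0)"
        using deg m by (simp add: has_degree_def)
      then show "Poly_Mapping.lookup a j = Poly_Mapping.lookup (m + var (i b)) j"
        by (auto simp: lookup_add lookup_var split: if_splits)
    qed
    then have "a - var (i b) = m" by simp
    moreover have "m \<in> upset A"
      using m ideal_gen_mult_right[of "v b" "monomial ` A" "q b"] vJ[OF b]
      unfolding J_def in_monomial_ideal_iff by blast
    ultimately show ?thesis
      using has_degree_imp_single[OF deg m] am
      by (auto simp: l_def C_def monomial_def mult_single koszul_vertex_def)
  qed
  define y where "y i = (\<lambda>d. monomial (a - var i) * x i d)" for i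
  have edge: "is_boundary F J (\<lambda>d. y j d - y k d)" if e: "koszul_edge (upset A) a j k" for j k
  proof -
    obtain m where m: "m \<in> upset A" "a = m + var j + var k"
      using e unfolding koszul_edge_def by blast
    then have "a - var j = m + var k" "a - var k = m + var j"
      by (simp_all add: poly_mapping_eq_iff fun_eq_iff lookup_add lookup_minus)
    \<comment> \<open>The bracket is a cycle over S, as both of its terms have boundary x_j x_k
      u.\<close>
    then have eq: "(\<lambda>d. y j d - y k d) =
        (\<lambda>d. monomial m * (monomial (var k) * x j d - monomial (var j) * x k d))"
      by (simp add: y_def fun_eq_iff algebra_simps flip: monomial_mult)
    have "monomial m \<in> J"
      using m(1) by (simp add: J_def in_monomial_ideal_iff keys_monomial)
    then show ?thesis
      unfolding eq J_def using x
      by (intro is_boundary_cycle[OF F]) (auto simp: chains_of_def bd_diff bd_mult fun_eq_iff)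
  qed
  have conn': "is_boundary F J (\<lambda>d. y j d - y k d)" if "(koszul_edge (upset A) a)\<^sup>*\<^sup>* j k" for j k
    using that
  proof induction
    case base
    show ?case using is_boundary_zero[of F "monomial ` A"] by (simp add: J_def)
  next
    case (step k l)
    then have "is_boundary F J (\<lambda>d. (y j d - y k d) + (y k d - y l d))"
      using edge[OF step(2)] unfolding J_def by (intro is_boundary_add)
    then show ?case by simp
  qed
  have vd: "(\<Sum>b\<in>gens F 1. v b * diff F 0 b c) = 0" if "c \<in> gens F 0" for c
    using fun_cong[OF cyc, of c] that by (simp add: bd_def)
  \<comment> \<open>Weighting the cycle condition by \<open>aug F c\<close> gives that the
    \<open>v b * p b\<close> sum to 0, and each of them is \<open>l b\<close> times x^a.\<close>
  have sum_l: "(\<Sum>b\<in>gens F 1. C (l b)) = 0"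
  proof -
    have "(\<Sum>b\<in>gens F 1. v b * p b) =
        (\<Sum>c\<in>gens F 0. (\<Sum>b\<in>gens F 1. v b * diff F 0 b c) * C (aug F c))"
      unfolding p_def sum_distrib_left sum_distrib_right by (subst sum.swap) (simp add: mult.assoc)
    then have "(\<Sum>b\<in>gens F 1. v b * p b) = 0"
      using vd by simp
    moreover have "v b * p b = Poly_Mapping.single a (l b)" if b: "b \<in> gens F 1" for b
    proof -
      have "v b * p b = C (l b) * monomial (a - var (i b)) * monomial (var (i b))"
        using q[OF b] vq[OF b] by (metis mult.assoc)
      then show ?thesis
        using vq[OF b] by (cases "l b = 0") (auto simp: C_def monomial_def mult_single)
    qed
    ultimately have "coef (\<Sum>b\<in>gens F 1. Poly_Mapping.single a (l b)) a = 0"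
      by simp
    then have "(\<Sum>b\<in>gens F 1. l b) = 0"
      by (simp add: lookup_sum)
    moreover have "(\<Sum>b\<in>gens F 1. C (l b)) = C (\<Sum>b\<in>gens F 1. l b)"
      unfolding C_def by (rule poly_mapping_eqI) (simp add: lookup_sum lookup_single when_def)
    ultimately show ?thesis by (simp add: C_def)
  qed
  define k where "k = (SOME k. koszul_vertex (upset A) a k)"
  \<comment> \<open>As the \<open>l b\<close> sum to 0, each \<open>y (i b)\<close> may be replaced
    by \<open>y (i b) - y k\<close>. The conditional covers those \<open>b\<close> whose
    \<open>i b\<close> need not be a vertex.\<close>
  have third: "is_boundary F J (\<lambda>d. \<Sum>b\<in>gens F 1. C (l b) * y (i b) d)"
  proof -
    have "is_boundary F J (if l b = 0 then (\<lambda>_. 0) else (\<lambda>d. y (i b) d - y k d))"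
      if b: "b \<in> gens F 1" for b
    proof (cases "l b = 0")
      case True
      then show ?thesis using is_boundary_zero[of F "monomial ` A"] by (simp add: J_def)
    next
      case False
      then have "koszul_vertex (upset A) a (i b)" using vq[OF b] by blast
      with False show ?thesis
        using conn'[OF conn[of "i b" k]] someI[of "koszul_vertex (upset A) a"] by (simp add: k_def)
    qed
    then have "is_boundary F J (\<lambda>d. \<Sum>b\<in>gens F 1.
        C (l b) * (if l b = 0 then (\<lambda>_. 0) else (\<lambda>d. y (i b) d - y k d)) d)"
      unfolding J_def by (rule is_boundary_sum)
    moreover have "C (l b) * (if l b = 0 then (\<lambda>_. 0) else (\<lambda>d. y (i b) d - y k d)) d =
        C (l b) * y (i b) d - C (l b) * y k d" for b d
      by (simp add: C_def right_diff_distrib)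
    ultimately show ?thesis
      by (simp add: sum_subtractf sum_distrib_right[symmetric] sum_l[unfolded One_nat_def])
  qed
  \<comment> \<open>The basis element \<open>b\<close> is corrected to a cycle: the sum over
    \<open>c\<close> removes its boundary except for \<open>p b * u\<close>, and the last term
    removes that.\<close>
  define g where "g b = (\<lambda>d. basis_chain b d - (\<Sum>c\<in>gens F 0. diff F 0 b c * z c d) - q b * x (i b) d)" for b
  have "is_boundary F J (\<lambda>d. v b * g b d)" if b: "b \<in> gens F 1" for b
    unfolding J_def
  proof (rule is_boundary_cycle[OF F])
    show "v b \<in> ideal_gen (monomial ` A)"
      using vJ[OF b] by (simp add: J_def)
    show "g b \<in> chains_of F UNIV 1"
      using basis_chain_in[OF b] z x(1) by (auto simp: g_def chains_of_def)
    have "(\<Sum>c\<in>gens F 0. diff F 0 b c * (basis_chain c d - C (aug F c) * u d)) =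
        (if d \<in> gens F 0 then diff F 0 b d else 0) - p b * u d" for d
    proof -
      have "(\<Sum>c\<in>gens F 0. diff F 0 b c * basis_chain c d) = (if d \<in> gens F 0 then diff F 0 b d else 0)"
        using fin by (rule sum_mult_basis_chain)
      then show ?thesis
        by (simp add: right_diff_distrib sum_subtractf p_def sum_distrib_right mult.assoc)
    qed
    then show "bd F 0 (g b) = (\<lambda>_. 0)"
      using z x(2) bd_basis_chain[OF fin, of b 0] b q[OF b]
      by (simp add: g_def bd_diff bd_sum bd_mult fun_eq_iff mult.assoc)
  qed
  then have "is_boundary F J (\<lambda>d. \<Sum>b\<in>gens F 1. 1 * (v b * g b d))"
    unfolding J_def by (rule is_boundary_sum)
  with third have "is_boundary F J (\<lambda>d. (\<Sum>b\<in>gens F 1. v b * g b d) + (\<Sum>b\<in>gens F 1. C (l b) * y (i b) d))"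
    unfolding J_def by (intro is_boundary_add) simp_all
  \<comment> \<open>After expanding \<open>g\<close>, the terms with \<open>z\<close> vanish since
    \<open>v\<close> is a cycle, and those with \<open>x\<close> cancel against the second
    sum.\<close>
  moreover have "(\<Sum>b\<in>gens F 1. v b * g b d) + (\<Sum>b\<in>gens F 1. C (l b) * y (i b) d) = v d" for d
  proof -
    have "(\<Sum>b\<in>gens F 1. C (l b) * y (i b) d) = (\<Sum>b\<in>gens F 1. v b * (q b * x (i b) d))"
      using vq by (intro sum.cong) (simp_all add: y_def mult.assoc[symmetric])
    moreover have "(\<Sum>b\<in>gens F 1. v b * (\<Sum>c\<in>gens F 0. diff F 0 b c * z c d)) = 0"
    proof -
      have "(\<Sum>b\<in>gens F 1. v b * (\<Sum>c\<in>gens F 0. diff F 0 b c * z c d)) =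
          (\<Sum>c\<in>gens F 0. (\<Sum>b\<in>gens F 1. v b * diff F 0 b c) * z c d)"
        unfolding sum_distrib_left sum_distrib_right by (subst sum.swap) (simp add: mult.assoc)
      then show ?thesis using vd by simp
    qed
    moreover have "(\<Sum>b\<in>gens F 1. v b * basis_chain b d) = v d"
      using fin v by (auto simp: sum_mult_basis_chain chains_at_def chains_of_def)
    ultimately show ?thesis
      by (simp add: g_def right_diff_distrib sum_subtractf)
  qed
  ultimately show ?thesis by simp
qed

lemma tor_1_imp_disconnected:
  fixes A :: "('n \<Rightarrow>\<^sub>0 nat) set"
  assumes "tor_nonzero 1 (ideal_gen (monomial ` A) :: ('n, 'k::field) mpoly set)
    (\<lambda>j. int (Poly_Mapping.lookup a j))"
  obtains i j where "koszul_vertex (upset A) a i" "koszul_vertex (upset A) a j"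
    "\<not> (koszul_edge (upset A) a)\<^sup>*\<^sup>* i j"
proof (rule ccontr)
  assume neg: "\<not> thesis"
  let ?J = "ideal_gen (monomial ` A) :: ('n, 'k) mpoly set"
  let ?a = "\<lambda>j. int (Poly_Mapping.lookup a j)"
  obtain F where F: "graded_free_resolution F" "cycles_at F ?J 1 ?a \<noteq> boundaries_at F ?J 1 ?a"
    using assms unfolding tor_nonzero_def by blast
  have "cycles_at F ?J 1 ?a \<subseteq> boundaries_at F ?J 1 ?a"
  proof
    fix v assume "v \<in> cycles_at F ?J 1 ?a"
    then have v: "v \<in> chains_at F ?J 1 ?a" "bd F 0 v = (\<lambda>_. 0)"
      by (simp_all add: cycles_at_def)
    from boundary_homogeneous[OF F(1) v(1) cycle_is_boundary[OF F(1) v]] that neg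
    show "v \<in> boundaries_at F ?J 1 ?a" by blast
  qed
  with F boundaries_subset_cycles[OF F(1)] show False by blast
qed

section \<open>The Koszul resolution\<close>

text \<open>Used twice: on variables it supplies the order that signs and homotopy need, on sets of
  variables it names basis elements by naturals, as \<open>free_seq\<close> requires.\<close>

definition fin_code :: "'a::finite \<Rightarrow> nat"
  where "fin_code = (SOME f. inj f)"

lemma inj_fin_code: "inj (fin_code :: 'a::finite \<Rightarrow> nat)"
proof -
  have "\<exists>f :: 'a \<Rightarrow> nat. inj f"
    using finite_imp_inj_to_nat_seg[of "UNIV :: 'a set"] by auto
  then show ?thesis
    unfolding fin_code_def by (rule someI_ex)
qed

lemma fin_code_eq_iff [simp]: "fin_code x = fin_code y \<longleftrightarrow> x = y"
  by (simp add: inj_eq[OF inj_fin_code])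

lemma inv_fin_code [simp]: "inv fin_code (fin_code x) = x"
  by (rule inv_f_f[OF inj_fin_code])

definition lowest :: "'n::finite set \<Rightarrow> 'n"
  where "lowest T = (SOME t. t \<in> T \<and> (\<forall>s\<in>T. fin_code t \<le> fin_code s))"

lemma lowest_eqI:
  assumes "t \<in> T" "\<And>s. s \<in> T \<Longrightarrow> fin_code t \<le> fin_code s"
  shows "lowest T = t"
  unfolding lowest_def
proof (rule some_equality)
  fix r assume "r \<in> T \<and> (\<forall>s\<in>T. fin_code r \<le> fin_code s)"
  then have "fin_code r = fin_code t" using assms by (blast intro: antisym)
  then show "r = t" by simp
qed (use assms in auto)

lemma lowest:
  assumes "T \<noteq> {}"
  shows "lowest T \<in> T" "s \<in> T \<Longrightarrow> fin_code (lowest T) \<le> fin_code s"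
proof -
  obtain t where "t \<in> T" "\<forall>s\<in>T. fin_code t \<le> fin_code s"
    using arg_min_if_finite[of T fin_code] assms by (metis finite linorder_not_less)
  then have "lowest T = t" by (intro lowest_eqI) auto
  then show "lowest T \<in> T" "s \<in> T \<Longrightarrow> fin_code (lowest T) \<le> fin_code s"
    using \<open>t \<in> T\<close> \<open>\<forall>s\<in>T. fin_code t \<le> fin_code s\<close> by auto
qed

lemma lowest_singleton [simp]: "lowest {t} = t"
  by (rule lowest_eqI) auto

definition koszul_sign :: "'n::finite \<Rightarrow> 'n set \<Rightarrow> 'a::ring_1"
  where "koszul_sign j U = (-1) ^ card {l \<in> U. fin_code l < fin_code j}"

lemma koszul_sign_below: "(\<And>l. l \<in> U \<Longrightarrow> fin_code j \<le> fin_code l) \<Longrightarrow> koszul_sign j U = 1"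
  unfolding koszul_sign_def by (metis (mono_tags, lifting) card.empty empty_Collect_eq linorder_not_less power_0)

lemma koszul_sign_empty [simp]: "koszul_sign j {} = 1"
  by (simp add: koszul_sign_def)

lemma koszul_sign_insert:
  assumes "k \<notin> U"
  shows "koszul_sign j (insert k U) = (if fin_code k < fin_code j then - koszul_sign j U else koszul_sign j U)"
proof -
  have "{l \<in> insert k U. fin_code l < fin_code j} =
      (if fin_code k < fin_code j then insert k {l \<in> U. fin_code l < fin_code j}
       else {l \<in> U. fin_code l < fin_code j})"
    by auto
  then show ?thesis using assms by (simp add: koszul_sign_def)
qed

text \<open>The Koszul differential on all exterior degrees at once, read off by target: the
  coefficient at \<open>U\<close> collects the contributions of its one-element extensions.\<close>

definition koszul_diff :: "('n::finite set \<Rightarrow> ('n, 'k::field) mpoly) \<Rightarrow> 'n set \<Rightarrow> ('n, 'k) mpoly"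
  where "koszul_diff f U = (\<Sum>j\<in>-U. koszul_sign j U * (monomial (var j) * f (insert j U)))"

text \<open>Swapping the indices only shows that the sum equals its negative, which is inconclusive
  in characteristic 2. Hence the splitting along the order and the condition on the
  diagonal.\<close>

lemma sum_antisymmetric:
  fixes h :: "'n::finite \<Rightarrow> 'n \<Rightarrow> 'a::ab_group_add"
  assumes "\<And>j k. h j k = - h k j" "\<And>j. h j j = 0"
  shows "(\<Sum>j\<in>UNIV. \<Sum>k\<in>UNIV. h j k) = 0"
proof -
  let ?g = "\<lambda>j k. if fin_code j < fin_code k then h j k else 0"
  have "h j k = ?g j k - ?g k j" for j k
    using assms(1)[of j k] assms(2)[of j] by (cases "fin_code j" "fin_code k" rule: linorder_cases) auto
  then have "(\<Sum>j\<in>UNIV. \<Sum>k\<in>UNIV. h j k) = (\<Sum>j\<in>UNIV. \<Sum>k\<in>UNIV. ?g j k - ?g k j)"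
    by (intro sum.cong refl)
  also have "\<dots> = (\<Sum>j\<in>UNIV. \<Sum>k\<in>UNIV. ?g j k) - (\<Sum>j\<in>UNIV. \<Sum>k\<in>UNIV. ?g k j)"
    by (simp only: sum_subtractf)
  also have "(\<Sum>j\<in>UNIV. \<Sum>k\<in>UNIV. ?g k j) = (\<Sum>j\<in>UNIV. \<Sum>k\<in>UNIV. ?g j k)"
    by (rule sum.swap)
  finally show ?thesis by simp
qed

lemma koszul_diff_diff: "koszul_diff (koszul_diff f) = (\<lambda>_. 0)"
proof
  fix W
  define h where "h j k = (if j \<notin> W \<and> k \<notin> W \<and> j \<noteq> k then
    koszul_sign j W * koszul_sign k (insert j W) *
      (monomial (var j) * monomial (var k) * f (insert k (insert j W))) else 0)" for j k
  have "koszul_diff (koszul_diff f) W = (\<Sum>j\<in>-W. \<Sum>k\<in>-insert j W. h j k)"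
    unfolding koszul_diff_def sum_distrib_left
    by (intro sum.cong refl) (auto simp: h_def algebra_simps)
  also have "\<dots> = (\<Sum>j\<in>-W. \<Sum>k\<in>UNIV. h j k)"
    by (intro sum.cong refl sum.mono_neutral_left) (auto simp: h_def)
  also have "\<dots> = (\<Sum>j\<in>UNIV. \<Sum>k\<in>UNIV. h j k)"
    by (intro sum.mono_neutral_left) (auto simp: h_def)
  also have "\<dots> = 0"
  proof (rule sum_antisymmetric)
    fix j k
    show "h j k = - h k j"
      by (cases "fin_code j" "fin_code k" rule: linorder_cases)
        (auto simp: h_def koszul_sign_insert insert_commute ac_simps)
  qed (simp add: h_def)
  finally show "koszul_diff (koszul_diff f) W = 0" .
qed

section \<open>The contracting homotopy of the Koszul complex\<close>

definition free_below :: "'n::finite \<Rightarrow> ('n \<Rightarrow>\<^sub>0 nat) \<Rightarrow> bool"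
  where "free_below t m \<longleftrightarrow> (\<forall>l. fin_code l < fin_code t \<longrightarrow> Poly_Mapping.lookup m l = 0)"

lemma free_below_add_var: "free_below t (m + var t) \<longleftrightarrow> free_below t m"
  by (auto simp: free_below_def lookup_add lookup_var)

text \<open>The conditions on \<open>m\<close> single out the terms whose lowest variable is
  x_t.\<close>

definition lowest_quot :: "'n::finite \<Rightarrow> ('n, 'k::field) mpoly \<Rightarrow> ('n, 'k) mpoly"
  where "lowest_quot t f = (\<Sum>m | m \<in> Poly_Mapping.keys f \<and> Poly_Mapping.lookup m t > 0 \<and>
      free_below t m.
    Poly_Mapping.single (m - var t) (coef f m))"

lemma coef_lowest_quot:
  "coef (lowest_quot t f) m =
    (if free_below t m then coef f (m + var t) else 0)"
proof -
  let ?S = "{m. m \<in> Poly_Mapping.keys f \<and> Poly_Mapping.lookup m t > 0 \<and>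
      free_below t m}"
  have fin: "finite ?S"
    by (rule finite_subset[OF _ finite_keys[of f]]) blast
  have "k - var t = m \<longleftrightarrow> k = m + var t" if "k \<in> ?S" for k
    using that minus_var_add[of k t] by auto
  then have "coef (lowest_quot t f) m = (\<Sum>k\<in>?S. if k = m + var t then coef f k else 0)"
    unfolding lowest_quot_def lookup_sum by (intro sum.cong) (simp_all add: lookup_single when_def)
  also have "\<dots> = (if m + var t \<in> ?S then coef f (m + var t) else 0)"
    using fin by simp
  finally show ?thesis
    by (simp add: free_below_add_var lookup_add lookup_var in_keys_iff)
qed

lemma coef_var_mult:
  "coef (monomial (var j) * f) m = (if Poly_Mapping.lookup m j > 0 then coef f (m - var j) else 0)"
proof (cases "Poly_Mapping.lookup m j > 0")
  case True
  then obtain r where "m = r + var j" by (rule ex_var_add)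
  then show ?thesis
    using True coef_single_mult[of "var j" 1 f r] by (simp add: monomial_def add.commute)
next
  case False
  then have "m \<noteq> var j + l" for l
    by (auto simp: lookup_add)
  then show ?thesis
    using False coef_single_mult_other[of m "var j" 1 f] by (simp add: monomial_def)
qed

lemma lowest_quot_sum: "lowest_quot t (\<Sum>x\<in>X. f x) = (\<Sum>x\<in>X. lowest_quot t (f x))"
  by (rule poly_mapping_eqI) (auto simp: coef_lowest_quot lookup_sum intro!: sum.neutral)

lemma lowest_quot_add: "lowest_quot t (f + g) = lowest_quot t f + lowest_quot t g"
  by (rule poly_mapping_eqI) (simp add: coef_lowest_quot lookup_add)

lemma lowest_quot_sign:
  "lowest_quot t (koszul_sign j U * f) = koszul_sign j U * lowest_quot t f"
proof -
  have "koszul_sign j U = (1 :: ('a, 'b) mpoly) \<or> koszul_sign j U = (- 1 :: ('a, 'b) mpoly)"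
    unfolding koszul_sign_def by (cases "even (card {l \<in> U. fin_code l < fin_code j})") auto
  moreover have "lowest_quot t (- f) = - lowest_quot t f"
    by (rule poly_mapping_eqI) (simp add: coef_lowest_quot)
  ultimately show ?thesis by auto
qed

lemma lowest_quot_var_below:
  assumes "fin_code j < fin_code t"
  shows "lowest_quot t (monomial (var j) * f) = 0"
  using assms
  by (intro poly_mapping_eqI)
    (auto simp: coef_lowest_quot coef_var_mult lookup_add lookup_var free_below_def)

lemma lowest_quot_var_above:
  assumes "fin_code t < fin_code j"
  shows "lowest_quot t (monomial (var j) * f) = monomial (var j) * lowest_quot t f"
proof (rule poly_mapping_eqI)
  fix m
  have "t \<noteq> j" using assms by auto
  show "coef (lowest_quot t (monomial (var j) * f)) m = coef (monomial (var j) * lowest_quot t f) m"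
  proof (cases "Poly_Mapping.lookup m j > 0")
    case True
    then obtain r where r: "m = r + var j" by (rule ex_var_add)
    have "free_below t (r + var j) \<longleftrightarrow> free_below t r"
      using assms by (auto simp: free_below_def lookup_add lookup_var)
    moreover have "r + var j + var t - var j = r + var t"
      by (metis add.commute add.left_commute add_diff_cancel_left')
    ultimately show ?thesis
      using True by (auto simp: r coef_lowest_quot coef_var_mult lookup_add)
  next
    case False
    then show ?thesis using \<open>t \<noteq> j\<close> by (simp add: coef_lowest_quot coef_var_mult lookup_add lookup_var)
  qed
qed

lemma coef_lowest_quot_var:
  "coef (lowest_quot t (monomial (var t) * f)) m =
    (if free_below t m then coef f m else 0)"
  by (simp add: coef_lowest_quot coef_var_mult lookup_add lookup_var)

text \<open>So \<open>monomial (var t) * lowest_quot t f\<close> is the projection of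
  \<open>f\<close> to the terms with lowest variable x_t. The case \<open>m = 0\<close> is set apart
  because \<open>lowest {}\<close> is an arbitrary choice.\<close>

lemma coef_var_lowest_quot:
  "coef (monomial (var t) * lowest_quot t f) m =
    (if m \<noteq> 0 \<and> lowest (Poly_Mapping.keys m) = t then coef f m else 0)"
proof (cases "Poly_Mapping.lookup m t > 0")
  case True
  then have t: "t \<in> Poly_Mapping.keys m" by (simp add: in_keys_iff)
  then have "m \<noteq> 0" by auto
  have "free_below t (m - var t) \<longleftrightarrow>
      lowest (Poly_Mapping.keys m) = t"
  proof
    assume *: "free_below t (m - var t)"
    show "lowest (Poly_Mapping.keys m) = t"
    proof (rule lowest_eqI[OF t])
      fix s assume s: "s \<in> Poly_Mapping.keys m"
      show "fin_code t \<le> fin_code s"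
      proof (rule ccontr)
        assume "\<not> ?thesis"
        then have "Poly_Mapping.lookup (m - var t) s = 0" "s \<noteq> t" using * by (auto simp: free_below_def)
        with s show False by (simp add: lookup_minus lookup_var in_keys_iff)
      qed
    qed
  next
    assume *: "lowest (Poly_Mapping.keys m) = t"
    have "Poly_Mapping.lookup m l = 0" if "fin_code l < fin_code t" for l
      using lowest(2)[of "Poly_Mapping.keys m" l] \<open>m \<noteq> 0\<close> that by (auto simp: * in_keys_iff)
    then show "free_below t (m - var t)"
      by (simp add: free_below_def lookup_minus)
  qed
  then show ?thesis
    using True \<open>m \<noteq> 0\<close> minus_var_add[of m t] by (simp add: coef_var_mult coef_lowest_quot)
next
  case False
  have "lowest (Poly_Mapping.keys m) \<noteq> t" if "m \<noteq> 0"
  proof -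
    have "Poly_Mapping.keys m \<noteq> {}"
      using that by (auto simp: poly_mapping_eq_iff fun_eq_iff in_keys_iff set_eq_iff)
    then show ?thesis using lowest(1)[of "Poly_Mapping.keys m"] False by (auto simp: in_keys_iff)
  qed
  then show ?thesis using False by (auto simp: coef_var_mult)
qed

text \<open>
  In effect, \<open>x\<^sup>m \<otimes> U\<close> goes to \<open>x\<^sup>m / x\<^sub>t \<otimes> (U \<union> {t})\<close> if the lowest variable \<open>x\<^sub>t\<close> occurring in
  \<open>m\<close> or \<open>U\<close> does not occur in \<open>U\<close>, and to \<open>0\<close> otherwise.
\<close>

definition koszul_homotopy :: "('n::finite set \<Rightarrow> ('n, 'k::field) mpoly) \<Rightarrow> 'n set \<Rightarrow> ('n, 'k) mpoly"
  where "koszul_homotopy f T = lowest_quot (lowest T) (f (T - {lowest T}))"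

text \<open>The projections for the various lowest variables add up to everything except the
  constant term.\<close>

lemma koszul_homotopy_empty:
  "koszul_diff (koszul_homotopy f) {} = f {} - Poly_Mapping.single 0 (coef (f {}) 0)"
proof (rule poly_mapping_eqI)
  fix m
  have "koszul_diff (koszul_homotopy f) {} = (\<Sum>j\<in>UNIV. monomial (var j) * lowest_quot j (f {}))"
    unfolding koszul_diff_def koszul_homotopy_def
    by (rule sum.cong) auto
  then show "coef (koszul_diff (koszul_homotopy f) {}) m = coef (f {} - Poly_Mapping.single 0 (coef (f {}) 0)) m"
    by (auto simp: lookup_sum coef_var_lowest_quot lookup_minus lookup_single when_def)
qed

text \<open>With \<open>t\<close> lowest in \<open>U\<close>, the variables outside \<open>U\<close>
  split into \<open>L\<close> below and \<open>H\<close> above \<open>t\<close>. Contributions of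
  \<open>H\<close> cancel between the two summands. From \<open>L\<close> come the terms of
  \<open>f U\<close> whose lowest variable is below \<open>t\<close>, and from removing and
  reinserting \<open>t\<close> come all others.\<close>

lemma koszul_homotopy_nonempty:
  fixes f :: "'n::finite set \<Rightarrow> ('n, 'k::field) mpoly"
  assumes U: "U \<noteq> {}"
  shows "koszul_diff (koszul_homotopy f) U + koszul_homotopy (koszul_diff f) U = f U"
proof -
  define t where "t = lowest U"
  have t: "t \<in> U" "\<And>s. s \<in> U \<Longrightarrow> fin_code t \<le> fin_code s"
    using lowest[OF U] by (auto simp: t_def)
  define L where "L = {j :: 'n. fin_code j < fin_code t}"
  define H where "H = {j :: 'n. j \<notin> U \<and> fin_code t < fin_code j}"
  have U_eq: "insert t (U - {t}) = U" using t by auto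
  have below: "koszul_sign j V = (1 :: ('n, 'k) mpoly)" if "fin_code j \<le> fin_code t" "V \<subseteq> U" for j V
    using that t(2) by (intro koszul_sign_below) (meson order_trans subsetD)
  have low_L: "lowest (insert j U) = j" if "j \<in> L" for j
    using that t(2) by (intro lowest_eqI) (force simp: L_def)+
  have low_H: "lowest (insert j U) = t" if "j \<in> H" for j
    using that t by (intro lowest_eqI) (force simp: H_def)+
  have "x \<in> -U \<longleftrightarrow> x \<in> L \<union> H" for x
  proof (cases "x \<in> U")
    case True
    then show ?thesis using t(2)[OF True] by (simp add: L_def H_def)
  next
    case False
    then have "fin_code x < fin_code t \<or> fin_code t < fin_code x"
      using t(1) by (metis fin_code_eq_iff linorder_neqE_nat)
    with False show ?thesis by (auto simp: L_def H_def)
  qed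
  then have "-U = L \<union> H"
    by (rule set_eqI)
  have "L \<inter> H = {}"
    by (auto simp: L_def H_def)
  then have "koszul_diff (koszul_homotopy f) U =
      (\<Sum>j\<in>L. koszul_sign j U * (monomial (var j) * koszul_homotopy f (insert j U))) +
      (\<Sum>j\<in>H. koszul_sign j U * (monomial (var j) * koszul_homotopy f (insert j U)))"
    using \<open>-U = L \<union> H\<close> by (simp add: koszul_diff_def sum.union_disjoint)
  also have "(\<Sum>j\<in>L. koszul_sign j U * (monomial (var j) * koszul_homotopy f (insert j U))) =
      (\<Sum>j\<in>L. monomial (var j) * lowest_quot j (f U))"
  proof (rule sum.cong)
    fix j assume j: "j \<in> L"
    then have "j \<notin> U" using t(2) by (auto simp: L_def not_less[symmetric])
    then show "koszul_sign j U * (monomial (var j) * koszul_homotopy f (insert j U)) =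
        monomial (var j) * lowest_quot j (f U)"
      using j below[of j U] by (simp add: koszul_homotopy_def low_L) (simp add: L_def)
  qed simp
  finally have 1: "koszul_diff (koszul_homotopy f) U = (\<Sum>j\<in>L. monomial (var j) * lowest_quot j (f U)) +
      (\<Sum>j\<in>H. koszul_sign j U * (monomial (var j) * lowest_quot t (f (insert j U - {t}))))"
    using low_H by (simp add: koszul_homotopy_def[of f "insert _ U"])
  have "t \<notin> L \<union> H" by (simp add: L_def H_def)
  have "- (U - {t}) = insert t (L \<union> H)"
    using \<open>-U = L \<union> H\<close> t(1) by auto
  then have "koszul_diff f (U - {t}) =
      koszul_sign t (U - {t}) * (monomial (var t) * f U) +
      ((\<Sum>j\<in>L. koszul_sign j (U - {t}) * (monomial (var j) * f (insert j (U - {t})))) +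
      (\<Sum>j\<in>H. koszul_sign j (U - {t}) * (monomial (var j) * f (insert j (U - {t})))))"
    using \<open>L \<inter> H = {}\<close> \<open>t \<notin> L \<union> H\<close> unfolding koszul_diff_def
    by (simp add: sum.union_disjoint insert_absorb[OF t(1)])
  then have 2: "koszul_homotopy (koszul_diff f) U = lowest_quot t (monomial (var t) * f U) +
      (\<Sum>j\<in>H. koszul_sign j (U - {t}) * (monomial (var j) * lowest_quot t (f (insert j (U - {t})))))"
    unfolding koszul_homotopy_def t_def[symmetric]
    using below[of t "U - {t}"]
    by (simp add: lowest_quot_add lowest_quot_sum lowest_quot_sign lowest_quot_var_below
        lowest_quot_var_above L_def H_def)
  \<comment> \<open>Since \<open>t\<close> lies below \<open>j\<close>, removing it from
    \<open>U\<close> flips the sign.\<close>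
  have "koszul_sign j U * (monomial (var j) * lowest_quot t (f (insert j U - {t}))) =
      - (koszul_sign j (U - {t}) * (monomial (var j) * lowest_quot t (f (insert j (U - {t})))))"
    if j: "j \<in> H" for j
  proof -
    have "insert j U - {t} = insert j (U - {t})"
      using j by (auto simp: H_def)
    moreover have "koszul_sign j (insert t (U - {t})) = (- koszul_sign j (U - {t}) :: ('n, 'k) mpoly)"
      using j by (subst koszul_sign_insert) (auto simp: H_def)
    ultimately show ?thesis by (simp add: insert_absorb[OF t(1)])
  qed
  then have 3: "koszul_diff (koszul_homotopy f) U + koszul_homotopy (koszul_diff f) U =
      (\<Sum>j\<in>L. monomial (var j) * lowest_quot j (f U)) + lowest_quot t (monomial (var t) * f U)"
    unfolding 1 2 by (simp add: sum_negf)
  show ?thesis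
  proof (rule poly_mapping_eqI)
    fix m :: "'n \<Rightarrow>\<^sub>0 nat"
    have keys: "m \<noteq> 0 \<longleftrightarrow> Poly_Mapping.keys m \<noteq> {}"
      by (auto simp: poly_mapping_eq_iff fun_eq_iff in_keys_iff set_eq_iff)
    have "free_below t m \<longleftrightarrow>
        \<not> (m \<noteq> 0 \<and> lowest (Poly_Mapping.keys m) \<in> L)"
    proof (cases "m = 0")
      case False
      then have "Poly_Mapping.keys m \<noteq> {}" using keys by blast
      then obtain s where s: "lowest (Poly_Mapping.keys m) = s" "Poly_Mapping.lookup m s \<noteq> 0"
        "\<And>l. Poly_Mapping.lookup m l \<noteq> 0 \<Longrightarrow> fin_code s \<le> fin_code l"
        using lowest by (metis in_keys_iff)
      have "free_below t m \<longleftrightarrow> \<not> fin_code s < fin_code t"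
      proof
        assume *: "\<not> fin_code s < fin_code t"
        show "free_below t m"
          unfolding free_below_def
        proof (intro allI impI, rule ccontr)
          fix l assume "fin_code l < fin_code t" "Poly_Mapping.lookup m l \<noteq> 0"
          with s(3)[of l] * show False by linarith
        qed
      qed (use s(2) in \<open>auto simp: free_below_def\<close>)
      then show ?thesis using False s(1) by (simp add: L_def)
    qed (simp add: free_below_def)
    moreover have "(\<Sum>j\<in>L. if m \<noteq> 0 \<and> lowest (Poly_Mapping.keys m) = j then coef (f U) m else 0) =
        (if m \<noteq> 0 \<and> lowest (Poly_Mapping.keys m) \<in> L then coef (f U) m else 0)"
      by (cases "m = 0") simp_all
    ultimately show "coef (koszul_diff (koszul_homotopy f) U + koszul_homotopy (koszul_diff f) U) m = coef (f U) m"
      unfolding 3 lookup_add lookup_sum coef_var_lowest_quot coef_lowest_quot_var by simp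
  qed
qed

section \<open>The Koszul complex as a graded free resolution\<close>

definition koszul :: "('n::finite, 'k::field) free_seq"
  where "koszul = \<lparr>
    gens = \<lambda>i. fin_code ` {T :: 'n set. card T = i},
    shift = \<lambda>i b j. if j \<in> inv fin_code b then 1 else 0,
    diff = \<lambda>i b c. \<Sum>j\<in>UNIV. if j \<notin> inv fin_code c \<and> inv fin_code b = insert j (inv fin_code c)
      then koszul_sign j (inv fin_code c) * monomial (var j) else 0,
    aug = \<lambda>b. 1\<rparr>"

definition koszul_chain :: "nat \<Rightarrow> ('n::finite set \<Rightarrow> ('n, 'k::field) mpoly) \<Rightarrow> nat \<Rightarrow> ('n, 'k) mpoly"
  where "koszul_chain i f b = (if b \<in> fin_code ` {T :: 'n set. card T = i} then f (inv fin_code b) else 0)"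

lemma gens_koszul: "gens (koszul :: ('n::finite, 'k::field) free_seq) i = fin_code ` {T :: 'n set. card T = i}"
  by (simp add: koszul_def)

lemma koszul_chain_code: "koszul_chain i f (fin_code T) = (if card T = i then f T else 0)"
  by (auto simp: koszul_chain_def)

lemma chains_of_koszul:
  fixes v :: "nat \<Rightarrow> ('n::finite, 'k::field) mpoly"
  assumes "v \<in> chains_of koszul J i"
  shows "v = koszul_chain i (\<lambda>T. v (fin_code T))"
  using assms by (auto simp: chains_of_def koszul_chain_def gens_koszul fun_eq_iff)

lemma koszul_chain_in: "koszul_chain i f \<in> chains_of koszul UNIV i"
  by (auto simp: chains_of_def koszul_chain_def gens_koszul)

lemma inj_on_fin_code: "inj_on fin_code A"
  using inj_fin_code by (rule inj_on_subset) simp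

text \<open>At most one \<open>j\<close> contributes to an entry of the matrix \<open>diff\<close>;
  interchanging the sums turns matrix multiplication into the sum over one-element
  extensions.\<close>

lemma bd_koszul:
  fixes f :: "'n::finite set \<Rightarrow> ('n, 'k::field) mpoly"
  shows "bd koszul i (koszul_chain (Suc i) f) = koszul_chain i (koszul_diff f)"
proof
  fix b
  show "bd koszul i (koszul_chain (Suc i) f) b = koszul_chain i (koszul_diff f) b"
  proof (cases "b \<in> fin_code ` {T :: 'n set. card T = i}")
    case True
    then obtain U :: "'n set" where U: "b = fin_code U" "card U = i" by auto
    let ?s = "\<lambda>j. koszul_sign j U * monomial (var j) :: ('n, 'k) mpoly"
    have "bd koszul i (koszul_chain (Suc i) f) b =
        (\<Sum>T | card T = Suc i. f T * (\<Sum>j\<in>UNIV. if j \<notin> U \<and> T = insert j U then ?s j else 0))"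
      using True U by (simp add: bd_def gens_koszul sum.reindex[OF inj_on_fin_code] koszul_chain_code)
        (simp add: koszul_def cong: if_cong)
    also have "\<dots> = (\<Sum>j\<in>UNIV. \<Sum>T | card T = Suc i. if T = insert j U then if j \<notin> U then ?s j * f T else 0 else 0)"
      unfolding sum_distrib_left by (subst sum.swap) (auto intro!: sum.cong)
    also have "\<dots> = (\<Sum>j\<in>UNIV. if j \<notin> U then ?s j * f (insert j U) else 0)"
      using U(2) by (intro sum.cong) (auto simp: sum.delta)
    also have "\<dots> = (\<Sum>j\<in>-U. ?s j * f (insert j U))"
      by (simp add: sum.If_cases Compl_eq)
    finally show ?thesis
      using U by (simp add: koszul_chain_code koszul_diff_def mult.assoc)
  next
    case False
    then show ?thesis by (simp add: bd_def gens_koszul koszul_chain_def)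
  qed
qed

lemma aug_map_koszul:
  fixes f :: "'n::finite set \<Rightarrow> ('n, 'k::field) mpoly"
  shows "aug_map koszul (koszul_chain 0 f) = coef (f {}) 0"
proof -
  have "{T :: 'n set. card T = 0} = {{}}" by auto
  then show ?thesis
    by (simp add: aug_map_def gens_koszul koszul_chain_code) (simp add: koszul_def)
qed

lemma koszul_chain_cong: "(\<And>T. card T = i \<Longrightarrow> f T = g T) \<Longrightarrow> koszul_chain i f = koszul_chain i g"
  by (auto simp: koszul_chain_def fun_eq_iff)

lemma koszul_chain_eq_iff: "koszul_chain i f = koszul_chain i g \<longleftrightarrow> (\<forall>T. card T = i \<longrightarrow> f T = g T)"
  by (metis koszul_chain_code koszul_chain_cong)

lemma koszul_chain_zero: "koszul_chain i (\<lambda>_. 0) = (\<lambda>_. 0)"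
  by (auto simp: koszul_chain_def)

lemma koszul_resolution: "graded_free_resolution (koszul :: ('n::finite, 'k::field) free_seq)"
  unfolding graded_free_resolution_def
proof (intro conjI allI ballI impI)
  let ?K = "koszul :: ('n, 'k) free_seq"
  show "finite (gens ?K i)" for i by (simp add: gens_koszul)
  show "has_degree (\<lambda>j. shift ?K (Suc i) b j - shift ?K i c j) (diff ?K i b c)"
    if bc: "b \<in> gens ?K (Suc i)" "c \<in> gens ?K i" for i b c
  proof -
    obtain T U :: "'n set" where "b = fin_code T" "c = fin_code U"
      using bc unfolding gens_koszul by blast
    have "has_degree (\<lambda>j. (if j \<in> T then 1 else 0) - (if j \<in> U then 1 else 0))
        (if k \<notin> U \<and> T = insert k U then koszul_sign k U * monomial (var k) else 0 :: ('n, 'k) mpoly)" for k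
    proof (cases "k \<notin> U \<and> T = insert k U")
      case True
      have "Poly_Mapping.keys (koszul_sign k U * monomial (var k) :: ('n, 'k) mpoly) \<subseteq> {var k}"
        unfolding koszul_sign_def
        by (cases "even (card {l \<in> U. fin_code l < fin_code k})") (auto simp: keys_monomial in_keys_iff monomial_def)
      then show ?thesis
        using True by (auto simp: has_degree_def lookup_var)
    qed (auto simp: has_degree_zero)
    then show ?thesis
      unfolding \<open>b = _\<close> \<open>c = _\<close> by (simp add: koszul_def has_degree_sum cong: if_cong)
  qed
  show "shift ?K 0 b = (\<lambda>_. 0)" if "b \<in> gens ?K 0" for b
    using that by (auto simp: koszul_def fun_eq_iff)
  show "aug_map ?K ` chains_of ?K UNIV 0 = UNIV"
  proof -
    have "c \<in> aug_map ?K ` chains_of ?K UNIV 0" for c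
      using koszul_chain_in[of 0 "\<lambda>_. Poly_Mapping.single 0 c"] aug_map_koszul[of "\<lambda>_. Poly_Mapping.single 0 c"]
      by (metis image_eqI lookup_single_eq)
    then show ?thesis by auto
  qed
  show "bd ?K 0 ` chains_of ?K UNIV 1 = {v \<in> chains_of ?K UNIV 0. aug_map ?K v = 0}"
  proof (intro equalityI subsetI)
    fix v assume "v \<in> bd ?K 0 ` chains_of ?K UNIV 1"
    then obtain w where w: "w \<in> chains_of ?K UNIV 1" "v = bd ?K 0 w" by blast
    have "v = koszul_chain 0 (koszul_diff (\<lambda>T. w (fin_code T)))"
      unfolding w(2) by (subst chains_of_koszul[OF w(1)]) (simp add: bd_koszul)
    then show "v \<in> {v \<in> chains_of ?K UNIV 0. aug_map ?K v = 0}"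
      by (simp add: koszul_chain_in aug_map_koszul koszul_diff_def lookup_sum coef_var_mult)
  next
    fix v assume v: "v \<in> {v \<in> chains_of ?K UNIV 0. aug_map ?K v = 0}"
    define f where "f T = v (fin_code T)" for T :: "'n set"
    have vf: "v = koszul_chain 0 f"
      using chains_of_koszul[of v UNIV 0] v unfolding f_def by simp
    then have "coef (f {}) 0 = 0"
      using v aug_map_koszul[of f] by simp
    then have "bd ?K 0 (koszul_chain 1 (koszul_homotopy f)) = v"
      by (auto simp: vf bd_koszul koszul_homotopy_empty intro!: koszul_chain_cong)
    then show "v \<in> bd ?K 0 ` chains_of ?K UNIV 1"
      using koszul_chain_in by blast
  qed
  show "bd ?K (Suc i) ` chains_of ?K UNIV (i + 2) =
      {v \<in> chains_of ?K UNIV (Suc i). bd ?K i v = (\<lambda>_. 0)}" for i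
  proof (intro equalityI subsetI)
    fix v assume "v \<in> bd ?K (Suc i) ` chains_of ?K UNIV (i + 2)"
    then obtain w where w: "w \<in> chains_of ?K UNIV (Suc (Suc i))" "v = bd ?K (Suc i) w" by auto
    have "v = koszul_chain (Suc i) (koszul_diff (\<lambda>T. w (fin_code T)))"
      unfolding w(2) by (subst chains_of_koszul[OF w(1)]) (simp add: bd_koszul)
    then show "v \<in> {v \<in> chains_of ?K UNIV (Suc i). bd ?K i v = (\<lambda>_. 0)}"
      using koszul_chain_zero[of i] by (simp add: koszul_chain_in bd_koszul koszul_diff_diff)
  next
    fix v assume v: "v \<in> {v \<in> chains_of ?K UNIV (Suc i). bd ?K i v = (\<lambda>_. 0)}"
    define f where "f T = v (fin_code T)" for T :: "'n set"
    have vf: "v = koszul_chain (Suc i) f"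
      using chains_of_koszul[of v UNIV "Suc i"] v unfolding f_def by simp
    \<comment> \<open>Vanishing of \<open>f\<close> off the size \<open>Suc i\<close> makes
      \<open>koszul_diff f\<close> vanish on sets of every size, so the second homotopy term drops
      out.\<close>
    have f0: "f T = 0" if "card T \<noteq> Suc i" for T
      using that vf koszul_chain_code[of "Suc i" f T] by (simp add: f_def)
    have "koszul_chain i (koszul_diff f) = koszul_chain i (\<lambda>_. 0)"
      using v by (simp add: vf bd_koszul koszul_chain_zero)
    then have "koszul_diff f U = 0" if "card U = i" for U
      using that unfolding koszul_chain_eq_iff by blast
    moreover have "koszul_diff f U = 0" if "card U \<noteq> i" for U
      unfolding koszul_diff_def using that f0 by (intro sum.neutral) auto
    ultimately have "koszul_diff f = (\<lambda>_. 0)" by blast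
    then have "koszul_homotopy (koszul_diff f) U = 0" for U
      by (simp add: koszul_homotopy_def lowest_quot_def)
    then have "koszul_diff (koszul_homotopy f) U = f U" if "card U = Suc i" for U
      using koszul_homotopy_nonempty[of U f] that by (metis add.right_neutral card.empty nat.distinct(1))
    then have "bd ?K (Suc i) (koszul_chain (Suc (Suc i)) (koszul_homotopy f)) = v"
      by (auto simp: vf bd_koszul intro!: koszul_chain_cong)
    then show "v \<in> bd ?K (Suc i) ` chains_of ?K UNIV (i + 2)"
      using koszul_chain_in[of "Suc (Suc i)" "koszul_homotopy f"] by (metis add_2_eq_Suc' image_eqI)
  qed
qed

text \<open>The relation x_i u = x_j v is a Koszul cycle of total degree d + 1. A boundary in this
  degree would come from elements of the ideal of total degree d - 1, and the only such element is
  0.\<close>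

lemma linear_lcm_imp_tor_1:
  fixes B :: "('n::finite \<Rightarrow>\<^sub>0 nat) set"
  assumes B: "polymatroid_bases d B" and a: "a \<in> linear_lcms B"
  shows "tor_nonzero 1 (ideal_gen (monomial ` B) :: ('n, 'k::field) mpoly set) (\<lambda>j. int (Poly_Mapping.lookup a j))"
proof -
  let ?J = "ideal_gen (monomial ` B) :: ('n, 'k) mpoly set"
  let ?a = "\<lambda>j. int (Poly_Mapping.lookup a j)"
  let ?K = "koszul :: ('n, 'k) free_seq"
  obtain u v i j where uv: "u \<in> B" "v \<in> B" "i \<noteq> j" "a = u + var i" "a = v + var j"
    using a unfolding linear_lcms_def by blast
  have dega: "total_deg a = d + 1"
    using uv polymatroid_bases_deg[OF B] by (simp add: total_deg_add total_deg_var)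
  define f :: "'n set \<Rightarrow> ('n, 'k) mpoly"
    where "f T = (if T = {i} then monomial u else if T = {j} then - monomial v else 0)" for T
  have "koszul_chain 1 f \<in> cycles_at ?K ?J 1 ?a"
  proof -
    have in_J: "monomial u \<in> ?J" "- monomial v \<in> ?J"
      using uv ideal_gen_mult[of "monomial v" _ "-1"] by (auto intro: ideal_gen_base)
    have "koszul_chain 1 f \<in> chains_of ?K ?J 1"
      using in_J by (auto simp: chains_of_def koszul_chain_def gens_koszul f_def ideal_gen_zero)
    moreover have "has_degree (\<lambda>k. ?a k - shift ?K 1 (fin_code T) k) (f T)" if "card T = 1" for T
    proof -
      have "has_degree (\<lambda>k. ?a k - (if k \<in> T then 1 else 0)) (f T)"
      proof (cases "T = {i} \<or> T = {j}")
        case True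
        then show ?thesis
        proof
          assume T: "T = {i}"
          have "(\<lambda>k. ?a k - (if k \<in> T then 1 else 0)) = (\<lambda>k. int (Poly_Mapping.lookup u k))"
            by (auto simp: uv(4) T lookup_add lookup_var fun_eq_iff)
          moreover have "f T = Poly_Mapping.single u 1" by (simp add: f_def T monomial_def)
          ultimately show ?thesis by (simp add: has_degree_single)
        next
          assume T: "T = {j}"
          have "(\<lambda>k. ?a k - (if k \<in> T then 1 else 0)) = (\<lambda>k. int (Poly_Mapping.lookup v k))"
            by (auto simp: uv(5) T lookup_add lookup_var fun_eq_iff)
          moreover have "f T = Poly_Mapping.single v (-1)"
            using uv(3) by (simp add: f_def T monomial_def single_uminus)
          ultimately show ?thesis by (simp add: has_degree_single)
        qed
      qed (auto simp: f_def has_degree_zero)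
      then show ?thesis by (simp add: koszul_def)
    qed
    moreover have "koszul_diff f {} = 0"
    proof -
      have "koszul_diff f {} = (\<Sum>k\<in>UNIV. if k = i then monomial a else if k = j then - monomial a else 0)"
        unfolding koszul_diff_def
        by (rule sum.cong) (use uv in \<open>auto simp: koszul_sign_below f_def monomial_mult add.commute\<close>)
      also have "\<dots> = (\<Sum>k\<in>UNIV. (if k = i then monomial a else 0) + (if k = j then - monomial a else 0))"
        using uv(3) by (intro sum.cong) auto
      also have "\<dots> = 0" by (simp add: sum.distrib)
      finally show ?thesis .
    qed
    then have "bd ?K 0 (koszul_chain 1 f) = (\<lambda>_. 0)"
      using bd_koszul[of 0 f] by (auto simp: koszul_chain_def)
    ultimately show ?thesis
      by (auto simp: cycles_at_def chains_at_def gens_koszul koszul_chain_code)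
  qed
  moreover have "koszul_chain 1 f \<notin> boundaries_at ?K ?J 1 ?a"
  proof
    assume "koszul_chain 1 f \<in> boundaries_at ?K ?J 1 ?a"
    then obtain w where w: "w \<in> chains_at ?K ?J 2 ?a" "koszul_chain 1 f = bd ?K 1 w"
      by (auto simp: boundaries_at_def numeral_2_eq_2)
    \<comment> \<open>A basis element of F_2 uses up two of the d + 1 units of degree, leaving too
      few for a multiple of a generator.\<close>
    have w0: "w b = 0" if b: "b \<in> gens ?K 2" for b
    proof (rule ccontr)
      assume "w b \<noteq> 0"
      then obtain m where m: "m \<in> Poly_Mapping.keys (w b)" using keys_nonempty by blast
      obtain T :: "'n set" where T: "b = fin_code T" "card T = 2"
        using b by (auto simp: gens_koszul)
      have "w b \<in> ?J" and "has_degree (\<lambda>k. ?a k - shift ?K 2 b k) (w b)"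
        using w(1) b by (simp_all add: chains_at_def chains_of_def)
      then have "m \<in> upset B" and deg: "\<And>k. int (Poly_Mapping.lookup m k) + (if k \<in> T then 1 else 0) = ?a k"
        using m unfolding in_monomial_ideal_iff has_degree_def T(1) by (auto simp: koszul_def)
      then obtain g r where "m = g + r" "g \<in> B"
        by (auto elim: upsetE)
      then have "total_deg m \<ge> d"
        using polymatroid_bases_deg[OF B] by (simp add: total_deg_add)
      moreover have "Poly_Mapping.lookup m k + (if k \<in> T then 1 else 0) = Poly_Mapping.lookup a k" for k
        using deg[of k] by (auto split: if_splits)
      then have "total_deg a = (\<Sum>k\<in>UNIV. Poly_Mapping.lookup m k + (if k \<in> T then 1 else 0))"
        by (simp add: total_deg_def)
      then have "total_deg a = total_deg m + card T"
        by (simp add: total_deg_def sum.distrib sum.If_cases)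
      ultimately show False using T(2) dega by simp
    qed
    have "koszul_chain 1 f = (\<lambda>_. 0)"
      unfolding w(2) by (simp add: bd_def w0 numeral_2_eq_2[symmetric] fun_eq_iff)
    then have "f {i} = 0"
      using koszul_chain_code[of 1 f "{i}"] by simp
    then show False
      by (simp add: f_def monomial_def)
        (metis lookup_single_eq lookup_zero one_neq_zero)
  qed
  ultimately show ?thesis
    unfolding tor_nonzero_def using koszul_resolution by blast
qed

section \<open>Homological shift ideals of powers\<close>

text \<open>Three implications close a circle: nonzero Tor, disconnected graph, linear lcm, nonzero
  Tor.\<close>

lemma HS_1_polymatroid:
  fixes B :: "('n::finite \<Rightarrow>\<^sub>0 nat) set"
  assumes B: "polymatroid_bases d B"
  shows "HS 1 (ideal_gen (monomial ` B) :: ('n, 'k::field) mpoly set) =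
    ideal_gen (monomial ` linear_lcms B)"
proof -
  have "tor_nonzero 1 (ideal_gen (monomial ` B) :: ('n, 'k) mpoly set)
      (\<lambda>j. int (Poly_Mapping.lookup a j)) \<longleftrightarrow> a \<in> linear_lcms B" for a
    using linear_lcm_imp_tor_1[OF B] tor_1_imp_disconnected disconnected_imp_linear_lcm[OF B] by metis
  then show ?thesis
    unfolding HS_def by (simp add: Setcompr_eq_image)
qed

lemma HS_1_power:
  fixes B :: "('n::finite \<Rightarrow>\<^sub>0 nat) set"
  assumes B: "polymatroid_bases d B" and I: "I = (ideal_gen (monomial ` B) :: ('n, 'k::field) mpoly set)"
    and k: "k \<ge> 1"
  shows "HS 1 (ideal_power I (k + 1)) = ideal_mult I (HS 1 (ideal_power I k))"
proof -
  obtain l where l: "k = Suc l" using k by (cases k) auto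
  have HS: "HS 1 (ideal_power I n) = ideal_gen (monomial ` linear_lcms (multiple B n))" for n
    unfolding I ideal_power_monomial by (rule HS_1_polymatroid[OF polymatroid_bases_multiple[OF B]])
  show ?thesis
    unfolding l Suc_eq_plus1[symmetric] HS linear_lcms_multiple[OF B]
    by (simp only: I ideal_mult_monomial)
qed

section \<open>Generation over the Rees algebra\<close>

lemma span_over_zero: "0 \<in> span_over R A"
  unfolding span_over_def by (auto intro!: exI[of _ "{}"])

lemma span_over_base: "r \<in> R \<Longrightarrow> m \<in> A \<Longrightarrow> r * m \<in> span_over R A"
  unfolding span_over_def by (auto intro!: exI[of _ "{m}"] exI[of _ "\<lambda>_. r"])

text \<open>Both combinations are extended by zero coefficients to the union of their index sets,
  hence the condition \<open>0 \<in> R\<close>.\<close>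

lemma span_over_add:
  assumes R: "0 \<in> R" "\<And>x y. x \<in> R \<Longrightarrow> y \<in> R \<Longrightarrow> x + y \<in> R"
    and xy: "x \<in> span_over R A" "y \<in> span_over R A"
  shows "x + y \<in> span_over R A"
proof -
  obtain S r where S: "finite S" "S \<subseteq> A" "\<forall>m\<in>S. r m \<in> R" "x = (\<Sum>m\<in>S. r m * m)"
    using xy(1) unfolding span_over_def by blast
  obtain T t where T: "finite T" "T \<subseteq> A" "\<forall>m\<in>T. t m \<in> R" "y = (\<Sum>m\<in>T. t m * m)"
    using xy(2) unfolding span_over_def by blast
  define r' where "r' m = (if m \<in> S then r m else 0)" for m
  define t' where "t' m = (if m \<in> T then t m else 0)" for m
  have "x = (\<Sum>m\<in>S \<union> T. r' m * m)"
    unfolding S(4) using S T by (intro sum.mono_neutral_cong_left) (auto simp: r'_def)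
  moreover have "y = (\<Sum>m\<in>S \<union> T. t' m * m)"
    unfolding T(4) using S T by (intro sum.mono_neutral_cong_left) (auto simp: t'_def)
  ultimately have "x + y = (\<Sum>m\<in>S \<union> T. (r' m + t' m) * m)"
    by (simp add: distrib_right sum.distrib)
  moreover have "r' m + t' m \<in> R" for m
    using R S T by (simp add: r'_def t'_def)
  ultimately show ?thesis
    unfolding span_over_def using S T by (intro CollectI exI[of _ "S \<union> T"] exI[of _ "\<lambda>m. r' m + t' m"]) auto
qed

lemma span_over_mult:
  assumes "\<And>r. r \<in> R \<Longrightarrow> c * r \<in> R" "x \<in> span_over R A"
  shows "c * x \<in> span_over R A"
proof -
  obtain S r where S: "finite S" "S \<subseteq> A" "\<forall>m\<in>S. r m \<in> R" "x = (\<Sum>m\<in>S. r m * m)"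
    using assms(2) unfolding span_over_def by blast
  then have "c * x = (\<Sum>m\<in>S. (c * r m) * m)"
    by (simp add: sum_distrib_left mult.assoc)
  then show ?thesis
    unfolding span_over_def using S assms(1)
    by (intro CollectI exI[of _ S] exI[of _ "\<lambda>m. c * r m"]) auto
qed

lemma ideal_power_is_ideal: "\<exists>A. ideal_power I k = ideal_gen A"
  using ideal_gen_one[symmetric] by (cases k) (auto simp: ideal_mult_def)

text \<open>Both inclusions come from iterating the recursion: read as a decomposition it reduces f
  t^(k+1) to degree one, read as an inclusion it shows that products stay in the module.\<close>

lemma generated_in_degree_1:
  fixes I :: "('n, 'k::field) mpoly set"
  assumes I: "I = ideal_gen A"
    and step: "\<And>k. k \<ge> 1 \<Longrightarrow> HS i (ideal_power I (k + 1)) = ideal_mult I (HS i (ideal_power I k))"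
  shows "generated_in_degree 1 (rees I) (HS_rees i I)"
proof -
  let ?H = "\<lambda>k. HS i (ideal_power I k)"
  let ?G = "graded_component (HS_rees i I) 1"
  have Suc_step: "?H (Suc (Suc k)) = ideal_mult I (?H (Suc k))" for k
    using step[of "Suc k"] by simp
  have H_zero: "0 \<in> ?H k" for k
    unfolding HS_def by (rule ideal_gen_zero)
  have H_add: "x \<in> ?H k \<Longrightarrow> y \<in> ?H k \<Longrightarrow> x + y \<in> ?H k" for x y k
    unfolding HS_def by (rule ideal_gen_add)
  have H_mult: "x \<in> ?H k \<Longrightarrow> c * x \<in> ?H k" for c x k
    unfolding HS_def by (rule ideal_gen_mult)
  have P_zero: "0 \<in> ideal_power I k" for k
    using ideal_power_is_ideal[of I k] ideal_gen_zero by metis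
  have P_add: "x \<in> ideal_power I k \<Longrightarrow> y \<in> ideal_power I k \<Longrightarrow> x + y \<in> ideal_power I k" for x y k
    using ideal_power_is_ideal[of I k] ideal_gen_add by metis
  have R_zero: "0 \<in> rees I"
    by (simp add: rees_def P_zero)
  have R_one: "1 \<in> rees I"
    by (auto simp: rees_def P_zero coeff_1)
  have R_add: "p + q \<in> rees I" if "p \<in> rees I" "q \<in> rees I" for p q
    using that by (simp add: rees_def P_add)
  have R_monom: "monom g 1 * r \<in> rees I" if "g \<in> I" "r \<in> rees I" for g r
    unfolding rees_def
  proof (intro CollectI allI)
    fix k
    show "coeff (monom g 1 * r) k \<in> ideal_power I k"
      using that P_zero[of 0] ideal_mult_base[OF that(1)]
      by (cases k) (auto simp: rees_def coeff_monom_mult)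
  qed
  have span: "monom f (Suc k) \<in> span_over (rees I) ?G" if "f \<in> ?H (Suc k)" for f k
    using that
  proof (induction k arbitrary: f)
    case 0
    then have "monom f 1 \<in> ?G"
      using H_zero by (auto simp: graded_component_def HS_rees_def)
    from span_over_base[OF R_one this] show ?case by simp
  next
    case (Suc k)
    from Suc.prems have "f \<in> ideal_gen {g * h | g h. g \<in> I \<and> h \<in> ?H (Suc k)}"
      unfolding Suc_step ideal_mult_def .
    then show ?case
    proof (induction rule: ideal_gen_induct)
      case zero
      show ?case by (simp add: span_over_zero)
    next
      case (step c x y)
      then obtain g h where gh: "x = g * h" "g \<in> I" "h \<in> ?H (Suc k)" by blast
      have "c * g \<in> I" using gh(2) unfolding I by (rule ideal_gen_mult)
      with gh Suc.IH have "monom (c * g) 1 * monom h (Suc k) \<in> span_over (rees I) ?G"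
        by (intro span_over_mult R_monom) auto
      moreover have "monom (c * x + y) (Suc (Suc k)) =
          monom (c * g) 1 * monom h (Suc k) + monom y (Suc (Suc k))"
        by (simp add: gh(1) mult_monom add_monom mult.assoc)
      ultimately show ?case
        using step by (simp add: span_over_add[OF R_zero R_add])
    qed
  qed
  \<comment> \<open>Elements of the span have the form \<open>r * m\<close> with \<open>m\<close> of
    degree one, so the action on the degree-one component is all that the reverse inclusion
    requires.\<close>
  have action: "p * f \<in> ?H (Suc k)" if "p \<in> ideal_power I k" "f \<in> ?H (Suc 0)" for p f k
    using that(1)
  proof (induction k arbitrary: p)
    case 0
    show ?case using that(2) by (rule H_mult)
  next
    case (Suc k)
    from Suc.prems have "p \<in> ideal_gen {f * g | f g. f \<in> I \<and> g \<in> ideal_power I k}"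
      by (simp add: ideal_mult_def)
    then show ?case
    proof (induction rule: ideal_gen_induct)
      case zero
      show ?case by (simp only: mult_zero_left H_zero)
    next
      case (step c x y)
      then obtain g h where gh: "x = g * h" "g \<in> I" "h \<in> ideal_power I k" by blast
      have "g * (h * f) \<in> ?H (Suc (Suc k))"
        unfolding Suc_step using gh(2) Suc.IH[OF gh(3)] by (rule ideal_mult_base)
      then have "c * (g * (h * f)) + y * f \<in> ?H (Suc (Suc k))"
        using H_add[OF H_mult] step.IH by blast
      then show ?case
        by (simp only: gh(1) distrib_right mult.assoc)
    qed
  qed
  have "HS_rees i I \<subseteq> span_over (rees I) ?G"
  proof
    fix p assume "p \<in> HS_rees i I"
    then have p: "coeff p 0 = 0" "\<And>k. coeff p (Suc k) \<in> ?H (Suc k)"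
      unfolding HS_rees_def by auto
    have "(\<Sum>k\<in>K. monom (coeff p k) k) \<in> span_over (rees I) ?G" if "finite K" for K
      using that
    proof (induction K rule: finite_induct)
      case empty
      show ?case by (simp add: span_over_zero)
    next
      case (insert k K)
      have "monom (coeff p k) k \<in> span_over (rees I) ?G"
        using p(1) span[OF p(2)] by (cases k) (simp_all add: span_over_zero)
      with insert show ?case
        by (simp add: span_over_add[OF R_zero R_add])
    qed
    from this[of "{..degree p}"] show "p \<in> span_over (rees I) ?G"
      by (simp add: poly_as_sum_of_monoms)
  qed
  moreover have "span_over (rees I) ?G \<subseteq> HS_rees i I"
  proof
    fix p assume "p \<in> span_over (rees I) ?G"
    then obtain S r where S: "finite S" "S \<subseteq> ?G" "\<forall>m\<in>S. r m \<in> rees I" "p = (\<Sum>m\<in>S. r m * m)"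
      unfolding span_over_def by blast
    have member: "r m * m \<in> HS_rees i I" if m: "m \<in> S" for m
    proof -
      have "m \<in> ?G" using S(2) m by blast
      then have m1: "coeff m 1 \<in> ?H (Suc 0)" "\<And>k. k \<noteq> 1 \<Longrightarrow> coeff m k = 0"
        unfolding graded_component_def HS_rees_def by auto
      \<comment> \<open>Multiplication by such an \<open>m\<close> shifts the index of a coefficient
        by one, matching \<open>Suc k\<close> in \<open>action\<close>.\<close>
      have "m = monom (coeff m 1) 1"
        using m1(2) by (auto simp: poly_eq_iff)
      then have eq: "r m * m = monom (coeff m 1) 1 * r m"
        by (metis mult.commute)
      have "coeff (r m * m) 0 = 0" "coeff (r m * m) (Suc k) = coeff m 1 * coeff (r m) k" for k
        unfolding eq by (simp_all add: coeff_monom_mult)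
      moreover have "coeff m 1 * coeff (r m) k \<in> ?H (Suc k)" for k
        using S(3) m m1(1) action[of "coeff (r m) k" k "coeff m 1"]
        by (simp add: rees_def mult.commute)
      ultimately have coeffs: "coeff (r m * m) 0 = 0" "coeff (r m * m) (Suc k) \<in> ?H (Suc k)" for k
        by (simp_all only:)
      have "coeff (r m * m) k \<in> ?H k" if "k \<ge> 1" for k
        using that coeffs(2)[of "k - 1"] by simp
      with coeffs(1) show ?thesis
        unfolding HS_rees_def by blast
    qed
    show "p \<in> HS_rees i I"
      unfolding S(4) using S(1) member
    proof (induction S rule: finite_induct)
      case empty
      show ?case by (simp add: HS_rees_def H_zero)
    next
      case (insert m S)
      then show ?case by (simp add: HS_rees_def H_add)
    qed
  qed
  ultimately show ?thesis
    unfolding generated_in_degree_def by blast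
qed

theorem theorem4p1:
  fixes I :: "('n::finite, 'k::field) mpoly set"
  assumes "polymatroidal I"
  shows "(\<forall>k\<ge>1. HS 1 (ideal_power I (k + 1)) = ideal_mult I (HS 1 (ideal_power I k))) \<and>
    generated_in_degree 1 (rees I) (HS_rees 1 I)"
proof -
  obtain d B where B: "I = ideal_gen (monomial ` B)" "polymatroid_bases d B"
    using assms by (rule polymatroidal_imp_bases)
  have "HS 1 (ideal_power I (k + 1)) = ideal_mult I (HS 1 (ideal_power I k))" if "k \<ge> 1" for k
    using HS_1_power[OF B(2,1) that] .
  then show ?thesis
    using generated_in_degree_1[OF B(1)] by blast
qed

end
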